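(* Let $m,N\ge 1$ and let $(\alpha_0^{(1)},\ldots,\alpha_0^{(m)})\in\mathbb{Q}_p^m$ have a purely periodic multidimensional continued fraction of period $N$, $$(\alpha_0^{(1)},\ldots,\alpha_0^{(m)})=\left[\left(\overline{a_0^{(1)},\ldots,a_{N-1}^{(1)}}\right),\ldots,\left(\overline{a_0^{(m)},\ldots,a_{N-1}^{(m)}}\right)\right],$$ with characteristic polynomial $P(X)$, and let $\mu=\alpha_0^{(1)}\alpha_1^{(1)}\cdots\alpha_{N-1}^{(1)}$ be the root of $P(X)$ greatest in $p$-adic norm. Then: (a) $\mathbb{Q}(\mu)=\mathbb{Q}(\alpha_0^{(1)},\ldots,\alpha_0^{(m)})$; (b) $\mu\notin\mathbb{Q}$.
   Context: Let $p$ be an odd prime. Every $\alpha\in\mathbb{Q}_p$ can be written uniquely as $\alpha=\sum_{j=k}^{\infty}x_jp^j$ with $k\in\mathbb{Z}$ and $x_j\in\mathbb{Z}\cap(-\frac p2,\frac p2)$. The Browkin $s$-function is $s(\alpha)=\sum_{j=k}^{0}x_jp^j$ (the sum of the terms with $j\le 0$; it is $0$ if there are none). $p$-adic Jacobi--Perron algorithm of dimension $m$: on input $\bm{\alpha}_0=(\alpha_0^{(1)},\ldots,\alpha_0^{(m)})\in\mathbb{Q}_p^m$, for $n=0,1,2,\ldots$ put $a_n^{(i)}=s(\alpha_n^{(i)})$ for $i=1,\ldots,m$ (partial quotients). If $\alpha_n^{(m)}=a_n^{(m)}$ the algorithm stops; otherwise set $\alpha_{n+1}^{(1)}=\dfrac{1}{\alpha_n^{(m)}-a_n^{(m)}}$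 and $\alpha_{n+1}^{(i)}=\dfrac{\alpha_n^{(i-1)}-a_n^{(i-1)}}{\alpha_n^{(m)}-a_n^{(m)}}$ for $i=2,\ldots,m$, and continue. The $\alpha_n^{(i)}$ are the complete quotients; the sequences of partial quotients form the multidimensional continued fraction (MCF) of $\bm{\alpha}_0$. The MCF is purely periodic of period $N$ if the algorithm does not stop and $a_{k+N}^{(i)}=a_k^{(i)}$ for all $k\ge 0$ and $i=1,\ldots,m$. Its characteristic polynomial is the (monic) characteristic polynomial $P(X)$ of the $(m+1)\times(m+1)$ matrix $\mathcal{M}=\mathcal{A}_0\mathcal{A}_1\cdots\mathcal{A}_{N-1}$, where $$\mathcal{A}_n=\begin{pmatrix} a_n^{(1)}&1&0&\ldots&0\\ a_n^{(2)}&0&1&\ldots&0\\ \vdots&\vdots&\vdots&\vdots&\vdots\\ a_n^{(m)}&0&0&\ldots&1\\ 1&0&0&\ldots&0\end{pmatrix}.$$ The root of $P(X)$ greatest in $p$-adic norm is the element $\mu=\alpha_0^{(1)}\cdots\alpha_{N-1}^{(1)}\in\mathbb{Q}_p$. *)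

theory Defs
  imports
    "Berlekamp_Zassenhaus.Finite_Field"
    "Jordan_Normal_Form.Char_Poly"
begin

section \<open>The field of p-adic numbers\<close>

definition padic_abs :: "nat \<Rightarrow> rat \<Rightarrow> real" where
  "padic_abs p q = (if q = 0 then 0 else
     real p powi (int (multiplicity (int p) (snd (quotient_of q)))
                - int (multiplicity (int p) (fst (quotient_of q)))))"

context
  fixes p :: nat
  assumes p: "prime p"
begin

lemma p_gt_1: "real p > 1"
  using prime_gt_1_nat[OF p] by simp

lemma padic_abs_0 [simp]: "padic_abs p 0 = 0"
  by (simp add: padic_abs_def)

lemma padic_abs_divide:
  assumes "a \<noteq> 0" "b \<noteq> 0"
  shows "padic_abs p (of_int a / of_int b)
    = real p powi (int (multiplicity (int p) b) - int (multiplicity (int p) a))"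
proof -
  define q where "q = (of_int a / of_int b :: rat)"
  obtain c d where cd: "quotient_of q = (c, d)"
    by (cases "quotient_of q")
  have d: "d > 0" using quotient_of_denom_pos[OF cd] .
  have q: "q = of_int c / of_int d" using quotient_of_div[OF cd] .
  have q0: "q \<noteq> 0" using assms by (simp add: q_def)
  then have c0: "c \<noteq> 0" using q by auto
  have "(of_int (a * d) :: rat) = of_int (c * b)"
    using q assms d unfolding q_def by (simp add: field_simps)
  then have eq: "a * d = c * b" by (simp only: of_int_eq_iff)
  have pe: "prime_elem (int p)" using p by simp
  have "multiplicity (int p) a + multiplicity (int p) d = multiplicity (int p) c + multiplicity (int p) b"
    using prime_elem_multiplicity_mult_distrib[OF pe, of a d]
      prime_elem_multiplicity_mult_distrib[OF pe, of c b] assms d c0 eq by simp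
  then have "int (multiplicity (int p) d) - int (multiplicity (int p) c)
      = int (multiplicity (int p) b) - int (multiplicity (int p) a)" by linarith
  then show ?thesis
    using q0 cd unfolding padic_abs_def q_def[symmetric] by simp
qed

lemma rat_nonzero_cases:
  fixes q :: rat
  obtains a b where "b \<noteq> 0" "q = of_int a / of_int b" "a = 0 \<longleftrightarrow> q = 0"
proof -
  obtain c d where cd: "quotient_of q = (c, d)"
    by (cases "quotient_of q")
  have d: "d > 0" using quotient_of_denom_pos[OF cd] .
  have q: "q = of_int c / of_int d" using quotient_of_div[OF cd] .
  show ?thesis by (rule that[of d c]) (use d q in auto)
qed

lemma padic_abs_eq_0 [simp]: "padic_abs p q = 0 \<longleftrightarrow> q = 0"
  using p_gt_1 by (simp add: padic_abs_def)

lemma padic_abs_nonneg [simp]: "padic_abs p q \<ge> 0"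
  by (simp add: padic_abs_def)

lemma padic_abs_pos: "q \<noteq> 0 \<Longrightarrow> padic_abs p q > 0"
  using padic_abs_nonneg[of q] padic_abs_eq_0[of q] by linarith

lemma padic_abs_mult: "padic_abs p (q * r) = padic_abs p q * padic_abs p r"
proof (cases "q = 0 \<or> r = 0")
  case True then show ?thesis by auto
next
  case False
  obtain a b where ab: "b \<noteq> 0" "q = of_int a / of_int b" "a = 0 \<longleftrightarrow> q = 0" by (rule rat_nonzero_cases)
  obtain c d where cd: "d \<noteq> 0" "r = of_int c / of_int d" "c = 0 \<longleftrightarrow> r = 0" by (rule rat_nonzero_cases)
  have pe: "prime_elem (int p)" using p by simp
  have qr: "q * r = of_int (a * c) / of_int (b * d)" by (simp add: ab(2) cd(2))
  have "padic_abs p (q * r) = real p powi (int (multiplicity (int p) (b * d)) - int (multiplicity (int p) (a * c)))"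
    unfolding qr by (rule padic_abs_divide) (use False ab(1,3) cd(1,3) in auto)
  also have "\<dots> = real p powi ((int (multiplicity (int p) b) - int (multiplicity (int p) a))
      + (int (multiplicity (int p) d) - int (multiplicity (int p) c)))"
    using False ab(1,3) cd(1,3) pe by (simp add: prime_elem_multiplicity_mult_distrib algebra_simps)
  also have "\<dots> = padic_abs p q * padic_abs p r"
    using False ab(1,3) cd(1,3) p_gt_1
    by (simp add: ab(2)[THEN arg_cong, of "padic_abs p"] cd(2)[THEN arg_cong, of "padic_abs p"]
        padic_abs_divide power_int_add)
  finally show ?thesis .
qed

lemma padic_abs_1 [simp]: "padic_abs p 1 = 1"
  using padic_abs_divide[of 1 1] by simp

lemma padic_abs_minus [simp]: "padic_abs p (- q) = padic_abs p q"
proof -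
  have "padic_abs p (-1) = 1" using padic_abs_divide[of "-1" 1] by (simp add: multiplicity_unit_right)
  then show ?thesis using padic_abs_mult[of "-1" q] by simp
qed

lemma padic_abs_minus_commute: "padic_abs p (q - r) = padic_abs p (r - q)"
  using padic_abs_minus[of "q - r"] by simp

lemma padic_abs_inverse: "padic_abs p (inverse q) = inverse (padic_abs p q)"
proof (cases "q = 0")
  case False
  then have "padic_abs p (inverse q) * padic_abs p q = 1"
    by (simp flip: padic_abs_mult)
  then show ?thesis by (metis inverse_unique mult.commute)
qed simp

lemma padic_abs_ultra: "padic_abs p (q + r) \<le> max (padic_abs p q) (padic_abs p r)"
proof (cases "q = 0 \<or> r = 0 \<or> q + r = 0")
  case True then show ?thesis by (auto simp: le_max_iff_disj)
next
  case False
  obtain a b where ab: "b \<noteq> 0" "q = of_int a / of_int b" "a = 0 \<longleftrightarrow> q = 0" by (rule rat_nonzero_cases)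
  obtain c d where cd: "d \<noteq> 0" "r = of_int c / of_int d" "c = 0 \<longleftrightarrow> r = 0" by (rule rat_nonzero_cases)
  let ?m = "multiplicity (int p)"
  have q: "q = of_int (a * d) / of_int (b * d)" and r: "r = of_int (c * b) / of_int (b * d)"
    using ab(1) cd(1) by (simp_all add: ab(2) cd(2))
  have qr: "q + r = of_int (a * d + c * b) / of_int (b * d)"
    unfolding q r by (simp add: add_divide_distrib)
  have "a * d + c * b \<noteq> 0"
  proof
    assume "a * d + c * b = 0"
    then have "q + r = 0" by (simp only: qr)
    with False show False by simp
  qed
  then have nz: "a * d \<noteq> 0" "c * b \<noteq> 0" "b * d \<noteq> 0" "a * d + c * b \<noteq> 0"
    using False ab(1,3) cd(1,3) by auto
  have "int p ^ min (?m (a * d)) (?m (c * b)) dvd a * d + c * b"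
    by (intro dvd_add multiplicity_dvd') auto
  then have "min (?m (a * d)) (?m (c * b)) \<le> ?m (a * d + c * b)"
    using nz p by (intro multiplicity_geI) auto
  moreover have "padic_abs p q = real p powi (int (?m (b * d)) - int (?m (a * d)))"
    "padic_abs p r = real p powi (int (?m (b * d)) - int (?m (c * b)))"
    "padic_abs p (q + r) = real p powi (int (?m (b * d)) - int (?m (a * d + c * b)))"
    using padic_abs_divide[OF nz(1,3)] padic_abs_divide[OF nz(2,3)] padic_abs_divide[OF nz(4,3)]
    by (simp_all only: flip: q r qr)
  moreover have "real p powi (M - int k) \<le> max (real p powi (M - int i)) (real p powi (M - int j))"
    if "min i j \<le> k" for M i j k
    using that p_gt_1 by (cases "i \<le> j") (auto simp: le_max_iff_disj intro!: power_int_increasing)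
  ultimately show ?thesis by metis
qed

lemma padic_abs_triangle: "padic_abs p (q + r) \<le> padic_abs p q + padic_abs p r"
  using padic_abs_ultra[of q r] padic_abs_nonneg[of q] padic_abs_nonneg[of r] by linarith

lemma padic_abs_triangle4: "padic_abs p (q - r) \<le> padic_abs p q + padic_abs p r"
  using padic_abs_triangle[of q "- r"] by simp

lemma padic_abs_triangle3: "\<bar>padic_abs p q - padic_abs p r\<bar> \<le> padic_abs p (q - r)"
  using padic_abs_triangle[of "q - r" r] padic_abs_triangle[of "r - q" q] padic_abs_minus_commute[of q r]
  by simp

end

text \<open>\<open>\<rat>\<^sub>p\<close> is the completion of \<open>\<rat>\<close>: the ring of Cauchy sequences modulo the ideal of null
  sequences for \<^const>\<open>padic_abs\<close>. The prime \<open>p\<close> is the cardinality of the index type;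
  the class \<^class>\<open>prime_card\<close> admits the finite types of any prime cardinality.\<close>

definition padic_cauchy :: "nat \<Rightarrow> (nat \<Rightarrow> rat) \<Rightarrow> bool" where
  "padic_cauchy p X \<longleftrightarrow> (\<forall>e>0. \<exists>N. \<forall>m\<ge>N. \<forall>n\<ge>N. padic_abs p (X m - X n) < e)"

context
  fixes p :: nat
  assumes p: "prime p"
begin

lemma padic_cauchyD:
  assumes "padic_cauchy p X" "e > 0"
  obtains N where "\<And>m n. m \<ge> N \<Longrightarrow> n \<ge> N \<Longrightarrow> padic_abs p (X m - X n) < e"
  using assms unfolding padic_cauchy_def by meson

lemma padic_cauchy_const: "padic_cauchy p (\<lambda>_. c)"
  using p by (simp add: padic_cauchy_def)

lemma padic_cauchy_convergent:
  assumes "padic_cauchy p X"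
  shows "convergent (\<lambda>n. padic_abs p (X n))"
proof (rule Cauchy_convergent, rule metric_CauchyI)
  fix e :: real assume "e > 0"
  with assms obtain N where N: "\<And>m n. m \<ge> N \<Longrightarrow> n \<ge> N \<Longrightarrow> padic_abs p (X m - X n) < e"
    by (rule padic_cauchyD) blast
  show "\<exists>M. \<forall>m\<ge>M. \<forall>n\<ge>M. dist (padic_abs p (X m)) (padic_abs p (X n)) < e"
  proof (intro exI allI impI)
    fix m n assume "m \<ge> N" "n \<ge> N"
    then show "dist (padic_abs p (X m)) (padic_abs p (X n)) < e"
      using N[of m n] padic_abs_triangle3[OF p, of "X m" "X n"] by (simp add: dist_real_def)
  qed
qed

lemma padic_cauchy_bounded:
  assumes "padic_cauchy p X"
  obtains B where "B > 0" "\<And>n. padic_abs p (X n) \<le> B"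
proof -
  obtain B where B: "B > 0" "\<And>n. norm (padic_abs p (X n)) \<le> B"
    using convergent_imp_Bseq[OF padic_cauchy_convergent[OF assms]] unfolding Bseq_def by blast
  show thesis by (rule that[of B]) (use B padic_abs_nonneg[OF p] in auto)
qed

lemma padic_cauchy_bound:
  assumes "\<And>m n. padic_abs p (Z m - Z n) \<le> C * padic_abs p (X m - X n) + D * padic_abs p (Y m - Y n)"
    and "padic_cauchy p X" "padic_cauchy p Y" "C > 0" "D > 0"
  shows "padic_cauchy p Z"
  unfolding padic_cauchy_def
proof (intro allI impI)
  fix e :: real assume e: "e > 0"
  from e assms have "e / (2 * C) > 0" "e / (2 * D) > 0" by auto
  then obtain N M where N: "\<And>m n. m \<ge> N \<Longrightarrow> n \<ge> N \<Longrightarrow> padic_abs p (X m - X n) < e / (2 * C)"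
    and M: "\<And>m n. m \<ge> M \<Longrightarrow> n \<ge> M \<Longrightarrow> padic_abs p (Y m - Y n) < e / (2 * D)"
    by (metis assms(2,3) padic_cauchyD)
  show "\<exists>N. \<forall>m\<ge>N. \<forall>n\<ge>N. padic_abs p (Z m - Z n) < e"
  proof (intro exI[of _ "max N M"] allI impI)
    fix m n assume "max N M \<le> m" "max N M \<le> n"
    then have "C * padic_abs p (X m - X n) < e / 2" "D * padic_abs p (Y m - Y n) < e / 2"
      using N[of m n] M[of m n] assms(4,5) by (auto simp: field_simps)
    then show "padic_abs p (Z m - Z n) < e" using assms(1)[of m n] by linarith
  qed
qed

lemma padic_cauchy_add:
  assumes "padic_cauchy p X" "padic_cauchy p Y"
  shows "padic_cauchy p (\<lambda>n. X n + Y n)"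
proof (rule padic_cauchy_bound[where C = 1 and D = 1, OF _ assms])
  fix m n
  show "padic_abs p (X m + Y m - (X n + Y n)) \<le> 1 * padic_abs p (X m - X n) + 1 * padic_abs p (Y m - Y n)"
    using padic_abs_triangle[OF p, of "X m - X n" "Y m - Y n"] by (simp add: algebra_simps)
qed simp_all

lemma padic_cauchy_minus: "padic_cauchy p X \<Longrightarrow> padic_cauchy p (\<lambda>n. - X n)"
  unfolding padic_cauchy_def using padic_abs_minus_commute[OF p] by simp

lemma padic_cauchy_mult:
  assumes "padic_cauchy p X" "padic_cauchy p Y"
  shows "padic_cauchy p (\<lambda>n. X n * Y n)"
proof -
  obtain B where B: "B > 0" "\<And>n. padic_abs p (X n) \<le> B" using padic_cauchy_bounded[OF assms(1)] by metis
  obtain C where C: "C > 0" "\<And>n. padic_abs p (Y n) \<le> C" using padic_cauchy_bounded[OF assms(2)] by metis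
  show ?thesis
  proof (rule padic_cauchy_bound[where C = C and D = B, OF _ assms C(1) B(1)])
    fix m n
    have "X m * Y m - X n * Y n = Y m * (X m - X n) + X n * (Y m - Y n)" by (simp add: algebra_simps)
    then have "padic_abs p (X m * Y m - X n * Y n)
        \<le> padic_abs p (Y m) * padic_abs p (X m - X n) + padic_abs p (X n) * padic_abs p (Y m - Y n)"
      using padic_abs_triangle[OF p] by (simp flip: padic_abs_mult[OF p])
    also have "\<dots> \<le> C * padic_abs p (X m - X n) + B * padic_abs p (Y m - Y n)"
      using B(2)[of n] C(2)[of m] by (intro add_mono mult_right_mono) (auto simp: padic_abs_nonneg[OF p])
    finally show "padic_abs p (X m * Y m - X n * Y n) \<le> \<dots>" .
  qed
qed

lemma padic_null_bound:
  assumes "(\<lambda>n. padic_abs p (X n)) \<longlonglongrightarrow> 0" "eventually (\<lambda>n. padic_abs p (Y n) \<le> C * padic_abs p (X n)) sequentially"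
  shows "(\<lambda>n. padic_abs p (Y n)) \<longlonglongrightarrow> 0"
proof (rule tendsto_sandwich[OF _ assms(2) tendsto_const])
  show "(\<lambda>n. C * padic_abs p (X n)) \<longlonglongrightarrow> 0" using tendsto_mult_left[OF assms(1), of C] by simp
qed (simp add: padic_abs_nonneg[OF p])

lemma padic_null_add:
  assumes "(\<lambda>n. padic_abs p (X n)) \<longlonglongrightarrow> 0" "(\<lambda>n. padic_abs p (Y n)) \<longlonglongrightarrow> 0"
  shows "(\<lambda>n. padic_abs p (X n + Y n)) \<longlonglongrightarrow> 0"
proof (rule tendsto_sandwich[OF _ _ tendsto_const])
  show "(\<lambda>n. padic_abs p (X n) + padic_abs p (Y n)) \<longlonglongrightarrow> 0" using tendsto_add[OF assms] by simp
qed (simp_all add: padic_abs_nonneg[OF p] padic_abs_triangle[OF p])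

lemma padic_null_minus: "(\<lambda>n. padic_abs p (- X n)) \<longlonglongrightarrow> 0 \<longleftrightarrow> (\<lambda>n. padic_abs p (X n)) \<longlonglongrightarrow> 0"
  by (simp add: padic_abs_minus[OF p])

lemma padic_not_null:
  assumes "padic_cauchy p X" "\<not> (\<lambda>n. padic_abs p (X n)) \<longlonglongrightarrow> 0"
  obtains b where "b > 0" "eventually (\<lambda>n. padic_abs p (X n) > b) sequentially"
proof -
  obtain L where L: "(\<lambda>n. padic_abs p (X n)) \<longlonglongrightarrow> L"
    using padic_cauchy_convergent[OF assms(1)] by (auto simp: convergent_def)
  have "L \<ge> 0" by (rule LIMSEQ_le_const[OF L]) (auto simp: padic_abs_nonneg[OF p])
  with L assms(2) have "L > 0" by (cases "L = 0") auto
  then show ?thesis using that[of "L / 2"] order_tendstoD(1)[OF L, of "L / 2"] by auto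
qed

lemma padic_abs_diff_inverse:
  assumes "b > 0" "padic_abs p x > b" "padic_abs p y > b"
  shows "padic_abs p (inverse x - inverse y) \<le> inverse (b * b) * padic_abs p (x - y)"
proof -
  have nz: "x \<noteq> 0" "y \<noteq> 0" using assms padic_abs_0[OF p] by auto
  have "inverse x - inverse y = inverse (x * y) * (y - x)" using nz by (simp add: field_simps)
  then have "padic_abs p (inverse x - inverse y) = inverse (padic_abs p x * padic_abs p y) * padic_abs p (x - y)"
    by (simp add: padic_abs_mult[OF p] padic_abs_inverse[OF p] padic_abs_minus_commute[OF p, of x y])
  also have "\<dots> \<le> inverse (b * b) * padic_abs p (x - y)"
    using assms by (intro mult_right_mono le_imp_inverse_le mult_mono) (auto simp: padic_abs_nonneg[OF p])
  finally show ?thesis .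
qed

lemma padic_cauchy_inverse:
  assumes "padic_cauchy p X" "\<not> (\<lambda>n. padic_abs p (X n)) \<longlonglongrightarrow> 0"
  shows "padic_cauchy p (\<lambda>n. inverse (X n))"
  unfolding padic_cauchy_def
proof (intro allI impI)
  fix e :: real assume e: "e > 0"
  obtain b where b: "b > 0" "eventually (\<lambda>n. padic_abs p (X n) > b) sequentially"
    by (rule padic_not_null[OF assms])
  then obtain M where M: "\<And>n. n \<ge> M \<Longrightarrow> padic_abs p (X n) > b" by (auto simp: eventually_sequentially)
  have "e * (b * b) > 0" using e b by simp
  then obtain N where N: "\<And>m n. m \<ge> N \<Longrightarrow> n \<ge> N \<Longrightarrow> padic_abs p (X m - X n) < e * (b * b)"
    by (rule padic_cauchyD[OF assms(1)]) blast
  show "\<exists>N. \<forall>m\<ge>N. \<forall>n\<ge>N. padic_abs p (inverse (X m) - inverse (X n)) < e"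
  proof (intro exI[of _ "max N M"] allI impI)
    fix m n assume "max N M \<le> m" "max N M \<le> n"
    then have *: "b < padic_abs p (X m)" "b < padic_abs p (X n)" "padic_abs p (X m - X n) < e * (b * b)"
      using M N[of m n] by auto
    have "padic_abs p (inverse (X m) - inverse (X n)) \<le> inverse (b * b) * padic_abs p (X m - X n)"
      by (rule padic_abs_diff_inverse[OF b(1) *(1,2)])
    moreover have "inverse (b * b) * padic_abs p (X m - X n) < e"
      using *(3) b(1) by (simp add: field_simps)
    ultimately show "padic_abs p (inverse (X m) - inverse (X n)) < e" by linarith
  qed
qed

end

typedef 'p padic_seq = "{X. padic_cauchy CARD('p::prime_card) X}"
  using padic_cauchy_const[OF prime_card] by auto

setup_lifting type_definition_padic_seq

instantiation padic_seq :: (prime_card) comm_ring_1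
begin

lift_definition zero_padic_seq :: "'a padic_seq" is "\<lambda>_. 0"
  by (rule padic_cauchy_const[OF prime_card])

lift_definition one_padic_seq :: "'a padic_seq" is "\<lambda>_. 1"
  by (rule padic_cauchy_const[OF prime_card])

lift_definition plus_padic_seq :: "'a padic_seq \<Rightarrow> 'a padic_seq \<Rightarrow> 'a padic_seq"
  is "\<lambda>X Y n. X n + Y n"
  by (rule padic_cauchy_add[OF prime_card])

lift_definition uminus_padic_seq :: "'a padic_seq \<Rightarrow> 'a padic_seq" is "\<lambda>X n. - X n"
  by (rule padic_cauchy_minus[OF prime_card])

lift_definition minus_padic_seq :: "'a padic_seq \<Rightarrow> 'a padic_seq \<Rightarrow> 'a padic_seq"
  is "\<lambda>X Y n. X n - Y n"
  using padic_cauchy_add[OF prime_card _ padic_cauchy_minus[OF prime_card]] by fastforce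

lift_definition times_padic_seq :: "'a padic_seq \<Rightarrow> 'a padic_seq \<Rightarrow> 'a padic_seq"
  is "\<lambda>X Y n. X n * Y n"
  by (rule padic_cauchy_mult[OF prime_card])

instance
proof
  fix a b c :: "'a padic_seq"
  show "a * b * c = a * (b * c)" "a * b = b * a" "1 * a = a" "(a + b) * c = a * c + b * c"
    "a + b + c = a + (b + c)" "a + b = b + a" "0 + a = a" "- a + a = 0" "a - b = a + - b"
    by (transfer; simp add: algebra_simps)+
  show "(0 :: 'a padic_seq) \<noteq> 1"
    by transfer (simp add: fun_eq_iff)
qed

end

lift_definition padic_null :: "'p::prime_card padic_seq \<Rightarrow> bool"
  is "\<lambda>X. (\<lambda>n. padic_abs CARD('p) (X n)) \<longlonglongrightarrow> 0" .

lift_definition padic_const :: "rat \<Rightarrow> 'p::prime_card padic_seq" is "\<lambda>q _. q"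
  by (rule padic_cauchy_const[OF prime_card])

lift_definition padic_seq_norm :: "'p::prime_card padic_seq \<Rightarrow> real"
  is "\<lambda>X. lim (\<lambda>n. padic_abs CARD('p) (X n))" .

lift_definition padic_seq_inverse :: "'p::prime_card padic_seq \<Rightarrow> 'p padic_seq"
  is "\<lambda>X n. if (\<lambda>k. padic_abs CARD('p) (X k)) \<longlonglongrightarrow> 0 then 0 else inverse (X n)"
  subgoal for X
    by (cases "(\<lambda>k. padic_abs CARD('p) (X k)) \<longlonglongrightarrow> 0")
      (simp_all add: padic_cauchy_const[OF prime_card] padic_cauchy_inverse[OF prime_card])
  done

lemma padic_null_0 [simp]: "padic_null 0"
  by transfer (simp add: padic_abs_0[OF prime_card])

lemma padic_null_plus: "padic_null X \<Longrightarrow> padic_null Y \<Longrightarrow> padic_null (X + Y)"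
  by transfer (rule padic_null_add[OF prime_card])

lemma padic_null_uminus: "padic_null X \<Longrightarrow> padic_null (- X)"
  by transfer (simp add: padic_null_minus[OF prime_card])

lemma padic_null_diff_commute: "padic_null (X - Y) \<Longrightarrow> padic_null (Y - X)"
  using padic_null_uminus[of "X - Y"] by simp

lemma padic_null_diff_trans: "padic_null (X - Y) \<Longrightarrow> padic_null (Y - Z) \<Longrightarrow> padic_null (X - Z)"
  using padic_null_plus[of "X - Y" "Y - Z"] by simp

lemma padic_null_times:
  fixes X Y :: "'p::prime_card padic_seq"
  assumes "padic_null X"
  shows "padic_null (Y * X)"
proof -
  obtain B where B: "\<And>n. padic_abs CARD('p) (Rep_padic_seq Y n) \<le> B"
    using padic_cauchy_bounded[OF prime_card Rep_padic_seq[of Y, simplified]] by metis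
  have "\<forall>\<^sub>F n in sequentially. padic_abs CARD('p) (Rep_padic_seq (Y * X) n)
      \<le> B * padic_abs CARD('p) (Rep_padic_seq X n)"
    by (intro always_eventually allI)
      (auto simp: times_padic_seq.rep_eq padic_abs_mult[OF prime_card] padic_abs_nonneg[OF prime_card]
        intro!: mult_right_mono B)
  with assms show ?thesis
    unfolding padic_null.rep_eq by (rule padic_null_bound[OF prime_card])
qed

lemma padic_null_norm: "padic_null X \<longleftrightarrow> padic_seq_norm X = 0"
proof (transfer, goal_cases)
  case (1 X)
  then show ?case
    using padic_cauchy_convergent[OF prime_card 1] by (metis convergent_LIMSEQ_iff limI)
qed

lemma padic_seq_norm_LIMSEQ:
  "(\<lambda>n. padic_abs CARD('p) (Rep_padic_seq X n)) \<longlonglongrightarrow> padic_seq_norm (X :: 'p::prime_card padic_seq)"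
  using padic_cauchy_convergent[OF prime_card Rep_padic_seq[of X, simplified]]
  by (simp add: padic_seq_norm.rep_eq convergent_LIMSEQ_iff)

lemma padic_seq_norm_nonneg: "padic_seq_norm X \<ge> 0"
  by (rule LIMSEQ_le_const[OF padic_seq_norm_LIMSEQ]) (auto simp: padic_abs_nonneg[OF prime_card])

lemma padic_seq_norm_mult: "padic_seq_norm (X * Y) = padic_seq_norm X * padic_seq_norm Y"
proof (rule LIMSEQ_unique[OF padic_seq_norm_LIMSEQ])
  show "(\<lambda>n. padic_abs CARD('a) (Rep_padic_seq (X * Y) n)) \<longlonglongrightarrow> padic_seq_norm X * padic_seq_norm Y"
    using tendsto_mult[OF padic_seq_norm_LIMSEQ[of X] padic_seq_norm_LIMSEQ[of Y]]
    by (simp add: times_padic_seq.rep_eq padic_abs_mult[OF prime_card])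
qed

lemma padic_seq_norm_ultra: "padic_seq_norm (X + Y) \<le> max (padic_seq_norm X) (padic_seq_norm Y)"
  using LIMSEQ_le[OF padic_seq_norm_LIMSEQ[of "X + Y"]
      tendsto_max[OF padic_seq_norm_LIMSEQ[of X] padic_seq_norm_LIMSEQ[of Y]]]
  by (simp add: plus_padic_seq.rep_eq padic_abs_ultra[OF prime_card])

lemma padic_seq_norm_minus: "padic_seq_norm (- X) = padic_seq_norm X"
  by transfer (simp add: padic_abs_minus[OF prime_card])

lemma padic_seq_norm_const: "padic_seq_norm (padic_const q :: 'p::prime_card padic_seq) = padic_abs CARD('p) q"
  by transfer simp

lemma padic_seq_inverse_mult:
  assumes "\<not> padic_null X"
  shows "padic_null (padic_seq_inverse X * X - 1)"
  using assms
proof (transfer, goal_cases)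
  case (1 X)
  obtain b where b: "b > 0" "eventually (\<lambda>n. padic_abs CARD('a) (X n) > b) sequentially"
    by (rule padic_not_null[OF prime_card 1])
  then have "eventually (\<lambda>n. X n \<noteq> 0) sequentially"
    by (auto elim!: eventually_mono simp: padic_abs_0[OF prime_card])
  then show ?case
    by (intro tendsto_eventually) (auto elim!: eventually_mono simp: 1 padic_abs_0[OF prime_card])
qed

lemma padic_seq_inverse_null: "padic_null X \<Longrightarrow> padic_seq_inverse X = 0"
  by transfer simp

text \<open>Congruent nonzero elements have congruent inverses, by uniqueness of inverses in a
  commutative ring.\<close>

lemma padic_seq_inverse_cong:
  assumes "padic_null (X - Y)"
  shows "padic_null (padic_seq_inverse X - padic_seq_inverse Y)"
proof (cases "padic_null X")
  case True
  then have "padic_null Y" using padic_null_plus[OF padic_null_diff_commute[OF assms] True] by simp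
  with True show ?thesis by (simp add: padic_seq_inverse_null)
next
  case False
  then have nY: "\<not> padic_null Y" using padic_null_plus[OF assms] by force
  define I J where "I = padic_seq_inverse X" and "J = padic_seq_inverse Y"
  have "I - J = J * (I * X - 1) + (- (I * (J * Y - 1)) + - ((I * J) * (X - Y)))"
    by (simp add: algebra_simps)
  moreover have "padic_null (J * (I * X - 1))" "padic_null (I * (J * Y - 1))" "padic_null ((I * J) * (X - Y))"
    using padic_seq_inverse_mult[OF False] padic_seq_inverse_mult[OF nY] assms
    by (auto simp: I_def J_def intro: padic_null_times)
  ultimately show ?thesis
    unfolding I_def[symmetric] J_def[symmetric] by (metis padic_null_plus padic_null_uminus)
qed

quotient_type 'p padic = "'p::prime_card padic_seq" / "\<lambda>X Y. padic_null (X - Y)"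
  by (intro equivpI reflpI sympI transpI)
    (auto intro: padic_null_diff_commute padic_null_diff_trans)

instantiation padic :: (prime_card) field
begin

lift_definition zero_padic :: "'a padic" is 0 .

lift_definition one_padic :: "'a padic" is 1 .

lift_definition plus_padic :: "'a padic \<Rightarrow> 'a padic \<Rightarrow> 'a padic" is "(+)"
  by (simp add: add_diff_add padic_null_plus)

lift_definition uminus_padic :: "'a padic \<Rightarrow> 'a padic" is uminus
  using padic_null_diff_commute by simp

lift_definition minus_padic :: "'a padic \<Rightarrow> 'a padic \<Rightarrow> 'a padic" is "(-)"
proof -
  fix X X' Y Y' :: "'a padic_seq"
  assume "padic_null (X - X')" "padic_null (Y - Y')"
  then have "padic_null (X - X' + (Y' - Y))"
    by (blast intro: padic_null_plus padic_null_diff_commute)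
  then show "padic_null (X - Y - (X' - Y'))" by (simp add: algebra_simps)
qed

lift_definition times_padic :: "'a padic \<Rightarrow> 'a padic \<Rightarrow> 'a padic" is "(*)"
proof -
  fix X X' Y Y' :: "'a padic_seq"
  assume "padic_null (X - X')" "padic_null (Y - Y')"
  then have "padic_null (Y * (X - X') + X' * (Y - Y'))"
    by (blast intro: padic_null_plus padic_null_times)
  then show "padic_null (X * Y - X' * Y')" by (simp add: algebra_simps)
qed

lift_definition inverse_padic :: "'a padic \<Rightarrow> 'a padic" is padic_seq_inverse
  by (rule padic_seq_inverse_cong)

definition divide_padic :: "'a padic \<Rightarrow> 'a padic \<Rightarrow> 'a padic" where
  "divide_padic x y = x * inverse y"

instance
proof
  fix a b c :: "'a padic"
  show "a + b + c = a + (b + c)" "a + b = b + a" "0 + a = a" "- a + a = 0" "a - b = a + - b"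
    "a * b * c = a * (b * c)" "a * b = b * a" "1 * a = a" "(a + b) * c = a * c + b * c"
    by (transfer; simp add: algebra_simps)+
  have "padic_seq_norm (0 - 1 :: 'a padic_seq) = 1"
    by transfer (simp add: padic_abs_1[OF prime_card] padic_abs_minus[OF prime_card])
  then have "\<not> padic_null (0 - 1 :: 'a padic_seq)" by (simp add: padic_null_norm del: diff_0)
  then show "(0::'a padic) \<noteq> 1" by (simp add: zero_padic_def one_padic_def padic.abs_eq_iff)
  show "a \<noteq> 0 \<Longrightarrow> inverse a * a = 1" by transfer (simp add: padic_seq_inverse_mult)
  show "a div b = a * inverse b" by (rule divide_padic_def)
  show "inverse (0::'a padic) = 0" by transfer (simp add: padic_seq_inverse_null)
qed

end

lift_definition padic_norm :: "'p::prime_card padic \<Rightarrow> real" is padic_seq_norm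
proof -
  fix X Y :: "'p padic_seq"
  assume "padic_null (X - Y)"
  then have *: "padic_seq_norm (X - Y) = 0" "padic_seq_norm (Y - X) = 0"
    using padic_null_norm padic_null_diff_commute by blast+
  show "padic_seq_norm X = padic_seq_norm Y"
    using padic_seq_norm_ultra[of "X - Y" Y] padic_seq_norm_ultra[of "Y - X" X] *
      padic_seq_norm_nonneg[of X] padic_seq_norm_nonneg[of Y] by (simp add: max_def split: if_splits)
qed

lemma padic_norm_eq_0 [simp]: "padic_norm x = 0 \<longleftrightarrow> x = 0"
  by transfer (simp add: padic_null_norm)

lemma padic_norm_nonneg [simp]: "padic_norm x \<ge> 0"
  by transfer (rule padic_seq_norm_nonneg)

lemma padic_norm_mult: "padic_norm (x * y) = padic_norm x * padic_norm y"
  by transfer (rule padic_seq_norm_mult)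

lemma padic_norm_minus [simp]: "padic_norm (- x) = padic_norm x"
  by transfer (rule padic_seq_norm_minus)

lemma padic_norm_ultra: "padic_norm (x + y) \<le> max (padic_norm x) (padic_norm y)"
  by transfer (rule padic_seq_norm_ultra)

instance padic :: (prime_card) field_char_0
proof (standard, rule injI, goal_cases)
  case (1 m n)
  have nat: "(of_nat k :: 'a padic_seq) = padic_const (of_nat k)" for k
    by (induction k) (simp, transfer, simp, simp, transfer, simp)
  have "(of_nat k :: 'a padic) = abs_padic (of_nat k)" for k
    by (induction k) (simp_all add: zero_padic_def one_padic_def plus_padic.abs_eq)
  with 1 have "padic_null (padic_const (of_nat m) - padic_const (of_nat n) :: 'a padic_seq)"
    by (simp add: padic.abs_eq_iff nat)
  moreover have "padic_const (of_nat m) - padic_const (of_nat n) = (padic_const (of_nat m - of_nat n) :: 'a padic_seq)"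
    by transfer simp
  ultimately show ?case by (simp add: padic_null_norm padic_seq_norm_const padic_abs_eq_0[OF prime_card])
qed

instantiation padic :: (prime_card) metric_space
begin

definition dist_padic :: "'a padic \<Rightarrow> 'a padic \<Rightarrow> real" where
  "dist_padic x y = padic_norm (x - y)"

definition uniformity_padic :: "('a padic \<times> 'a padic) filter" where
  "uniformity_padic = (INF e\<in>{0<..}. principal {(x, y). dist x y < e})"

definition open_padic :: "'a padic set \<Rightarrow> bool" where
  "open_padic U \<longleftrightarrow> (\<forall>x\<in>U. eventually (\<lambda>(x', y). x' = x \<longrightarrow> y \<in> U) uniformity)"

instance
proof
  fix x y z :: "'a padic"
  show "dist x y = 0 \<longleftrightarrow> x = y" by (simp add: dist_padic_def)
  have "x - z + - (y - z) = x - y" by simp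
  then have "padic_norm (x - y) \<le> max (padic_norm (x - z)) (padic_norm (y - z))"
    using padic_norm_ultra[of "x - z" "- (y - z)"] by (simp only: padic_norm_minus)
  then show "dist x y \<le> dist x z + dist y z"
    using padic_norm_nonneg[of "x - z"] padic_norm_nonneg[of "y - z"]
    unfolding dist_padic_def by linarith
qed (simp_all add: uniformity_padic_def open_padic_def)

end

lemma padic_norm_0 [simp]: "padic_norm 0 = 0"
  by simp

lemma padic_norm_1 [simp]: "padic_norm (1 :: 'p::prime_card padic) = 1"
  using padic_norm_mult[of 1 "1 :: 'p padic"] by simp

lemma padic_norm_pos [simp]: "0 < padic_norm x \<longleftrightarrow> x \<noteq> 0"
  using padic_norm_nonneg[of x] by (auto simp: less_le)

lemma padic_norm_inverse: "padic_norm (inverse x) = inverse (padic_norm x)"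
proof (cases "x = 0")
  case False
  then have "padic_norm (inverse x) * padic_norm x = 1" by (simp flip: padic_norm_mult)
  then show ?thesis by (metis inverse_unique mult.commute)
qed simp

lemma padic_norm_divide: "padic_norm (x / y) = padic_norm x / padic_norm y"
  by (simp add: divide_inverse padic_norm_mult padic_norm_inverse)

lemma padic_norm_ultra_diff: "padic_norm (x - y) \<le> max (padic_norm x) (padic_norm y)"
  using padic_norm_ultra[of x "- y"] by simp

lemma padic_norm_minus_commute: "padic_norm (x - y) = padic_norm (y - x)"
  using padic_norm_minus[of "x - y"] by simp

lemma padic_norm_add_le: "padic_norm x \<le> B \<Longrightarrow> padic_norm y \<le> B \<Longrightarrow> padic_norm (x + y) \<le> B"
  using padic_norm_ultra[of x y] by linarith

lemma padic_norm_eq_close: "padic_norm (x - y) < padic_norm x \<Longrightarrow> padic_norm y = padic_norm x"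
  using padic_norm_ultra[of "x - y" y] padic_norm_ultra_diff[of x "x - y"] by auto

lemma padic_norm_sum_le:
  assumes "\<And>i. i \<in> A \<Longrightarrow> padic_norm (f i) \<le> B" "B \<ge> 0"
  shows "padic_norm (sum f A) \<le> B"
  using assms by (induction A rule: infinite_finite_induct) (auto intro: padic_norm_add_le)

lemma padic_norm_prod: "padic_norm (prod f A) = (\<Prod>i\<in>A. padic_norm (f i))"
  by (induction A rule: infinite_finite_induct) (auto simp: padic_norm_mult)

lemma padic_const_of_rat: "(of_rat q :: 'p::prime_card padic) = abs_padic (padic_const q)"
proof -
  have nat_seq: "(of_nat k :: 'p padic_seq) = padic_const (of_nat k)" for k
    by (induction k) (simp, transfer, simp, simp, transfer, simp)
  have nat: "(of_nat k :: 'p padic) = abs_padic (padic_const (of_nat k))" for k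
    unfolding nat_seq[symmetric]
    by (induction k) (simp_all add: zero_padic_def one_padic_def plus_padic.abs_eq)
  have minus: "abs_padic (padic_const (- r)) = - (abs_padic (padic_const r) :: 'p padic)" for r
    unfolding uminus_padic.abs_eq by (rule arg_cong[of _ _ abs_padic], transfer, simp)
  have int: "(of_int a :: 'p padic) = abs_padic (padic_const (of_int a))" for a
    by (cases a rule: int_cases2) (simp_all add: nat minus)
  have mult: "abs_padic (padic_const (r * t)) = (abs_padic (padic_const r) * abs_padic (padic_const t) :: 'p padic)" for r t
    unfolding times_padic.abs_eq by (rule arg_cong[of _ _ abs_padic], transfer, simp)
  obtain a b where ab: "q = Rat.Fract a b" "b > 0" by (cases q)
  have "abs_padic (padic_const q) * (of_int b :: 'p padic) = of_int a"
    using ab unfolding int mult[symmetric] by (simp add: Fract_of_int_quotient)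
  then show ?thesis using ab by (simp add: of_rat_rat field_simps)
qed

lemma padic_norm_of_rat: "padic_norm (of_rat q :: 'p::prime_card padic) = padic_abs CARD('p) q"
  by (simp add: padic_const_of_rat padic_norm.abs_eq padic_seq_norm_const)

lemma padic_rat_dense:
  fixes x :: "'p::prime_card padic"
  assumes "e > 0"
  obtains q where "padic_norm (x - of_rat q) < e"
proof -
  obtain X where x: "x = abs_padic X" by (metis Quotient_padic Quotient_abs_rep)
  obtain N where N: "\<And>m n. m \<ge> N \<Longrightarrow> n \<ge> N
      \<Longrightarrow> padic_abs CARD('p) (Rep_padic_seq X m - Rep_padic_seq X n) < e / 2"
    using padic_cauchyD[OF prime_card Rep_padic_seq[of X, simplified], of "e / 2"] assms by auto
  let ?q = "Rep_padic_seq X N"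
  have "padic_seq_norm (X - padic_const ?q) \<le> e / 2"
    by (rule LIMSEQ_le_const2[OF padic_seq_norm_LIMSEQ])
      (use less_imp_le[OF N] in \<open>auto simp: minus_padic_seq.rep_eq padic_const.rep_eq intro!: exI[of _ N]\<close>)
  then have "padic_norm (x - of_rat ?q) < e"
    using assms by (simp add: x padic_const_of_rat minus_padic.abs_eq padic_norm.abs_eq)
  then show ?thesis by (rule that)
qed

lemma padic_norm_cases:
  fixes x :: "'p::prime_card padic"
  assumes "x \<noteq> 0"
  obtains k where "padic_norm x = real CARD('p) powi k"
proof -
  obtain q where q: "padic_norm (x - of_rat q) < padic_norm x"
    using padic_rat_dense[of "padic_norm x" x] assms by auto
  then have "padic_norm x = padic_abs CARD('p) q"
    using padic_norm_eq_close[OF q] by (simp add: padic_norm_of_rat)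
  moreover from this have "q \<noteq> 0" using assms by (auto simp: padic_abs_0[OF prime_card])
  ultimately show ?thesis using that by (simp add: padic_abs_def)
qed

lemma card_gt_1: "real CARD('p::prime_card) > 1"
  by (rule p_gt_1[OF prime_card])

lemma padic_norm_less_1:
  fixes x :: "'p::prime_card padic"
  assumes "padic_norm x < 1"
  shows "padic_norm x \<le> 1 / CARD('p)"
proof (cases "x = 0")
  case False
  then obtain k where k: "padic_norm x = real CARD('p) powi k" by (rule padic_norm_cases)
  have "k < 0"
  proof (rule ccontr)
    assume "\<not> k < 0"
    then have "real CARD('p) powi 0 \<le> real CARD('p) powi k"
      using card_gt_1[where ?'p='p] by (intro power_int_increasing) auto
    with k assms show False by simp
  qed
  then have "real CARD('p) powi k \<le> real CARD('p) powi (-1)"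
    using card_gt_1[where ?'p='p] by (intro power_int_increasing) auto
  then show ?thesis using k by (simp add: power_int_minus divide_inverse)
qed simp

lemma padic_norm_of_int:
  "padic_norm (of_int a :: 'p::prime_card padic)
    = (if a = 0 then 0 else (1 / real CARD('p)) ^ multiplicity (int CARD('p)) a)"
proof (cases "a = 0")
  case False
  have "padic_norm (of_int a :: 'p padic) = padic_abs CARD('p) (of_int a / of_int 1)"
    using padic_norm_of_rat[of "of_int a", where ?'p='p] by simp
  also have "\<dots> = real CARD('p) powi (- int (multiplicity (int CARD('p)) a))"
    using False by (subst padic_abs_divide[OF prime_card]) auto
  finally show ?thesis using False by (simp add: power_int_minus power_one_over inverse_eq_divide)
qed simp

lemma padic_norm_of_int_le_1: "padic_norm (of_int a :: 'p::prime_card padic) \<le> 1"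
  using card_gt_1[where ?'p='p] by (auto simp: padic_norm_of_int intro!: power_le_one)

lemma padic_norm_of_int_dvd:
  assumes "int CARD('p) dvd a"
  shows "padic_norm (of_int a :: 'p::prime_card padic) \<le> 1 / CARD('p)"
proof -
  obtain b where b: "a = int CARD('p) * b" using assms by blast
  have "padic_norm (of_int (int CARD('p)) :: 'p padic) = 1 / CARD('p)"
    using card_gt_1[where ?'p='p] prime_card_int[where ?'a='p]
    by (subst padic_norm_of_int) (auto simp: multiplicity_prime)
  then show ?thesis
    using padic_norm_of_int_le_1[of b, where ?'p='p] card_gt_1[where ?'p='p]
    unfolding b of_int_mult padic_norm_mult by (simp add: field_simps)
qed

lemma padic_norm_of_int_not_dvd:
  "\<not> int CARD('p) dvd a \<Longrightarrow> padic_norm (of_int a :: 'p::prime_card padic) = 1"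
  by (subst padic_norm_of_int) (auto simp: not_dvd_imp_multiplicity_0)

lemma padic_norm_card_powi:
  "padic_norm (of_nat CARD('p) powi k :: 'p::prime_card padic) = real CARD('p) powi (- k)"
proof -
  have "padic_norm (of_int (int CARD('p)) :: 'p padic) = 1 / CARD('p)"
    using card_gt_1[where ?'p='p] prime_card_int[where ?'a='p]
    by (subst padic_norm_of_int) (auto simp: multiplicity_prime)
  then have 1: "padic_norm (of_nat CARD('p) :: 'p padic) = 1 / CARD('p)" by simp
  have 2: "padic_norm (x ^ n) = padic_norm x ^ n" for x :: "'p padic" and n
    by (induction n) (auto simp: padic_norm_mult)
  show ?thesis
    by (auto simp: power_int_def 1 2 padic_norm_divide power_one_over inverse_eq_divide)
qed

section \<open>Browkin's s-function\<close>

definition browkin_expansion :: "'p::prime_card padic \<Rightarrow> (int \<Rightarrow> int) \<Rightarrow> bool" where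
  "browkin_expansion \<alpha> x \<longleftrightarrow> (\<forall>j. 2 * \<bar>x j\<bar> < int CARD('p)) \<and>
     (\<exists>k. (\<forall>j<k. x j = 0) \<and>
       (\<lambda>i. of_int (x (k + int i)) * of_nat CARD('p) powi (k + int i)) sums \<alpha>)"

lemma browkin_digit:
  fixes x :: "'p::prime_card padic"
  assumes "odd CARD('p)" "padic_norm x \<le> 1"
  obtains d :: int where "2 * \<bar>d\<bar> < int CARD('p)" "padic_norm (x - of_int d) \<le> 1 / CARD('p)"
proof -
  let ?p = "int CARD('p)"
  obtain q where q: "padic_norm (x - of_rat q) < 1" using padic_rat_dense[of 1 x] by auto
  obtain a b where ab: "quotient_of q = (a, b)" by (cases "quotient_of q")
  have b: "b > 0" "coprime a b" and qab: "q = of_int a / of_int b"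
    using quotient_of_denom_pos[OF ab] quotient_of_coprime[OF ab] quotient_of_div[OF ab] by auto
  have rq: "(of_rat q :: 'p padic) = of_int a / of_int b" by (simp add: qab of_rat_divide)
  have "padic_norm (of_rat q :: 'p padic) \<le> 1"
    using padic_norm_ultra_diff[of x "x - of_rat q"] assms(2) q by auto
  then have nab: "padic_norm (of_int a :: 'p padic) \<le> padic_norm (of_int b :: 'p padic)"
    using b by (simp add: rq padic_norm_divide divide_le_eq split: if_splits)
  have ndvd: "\<not> ?p dvd b"
  proof
    assume *: "?p dvd b"
    then have "\<not> ?p dvd a"
      using b(2) prime_card_int[where ?'a='p] by (meson coprime_common_divisor not_prime_unit)
    then show False
      using order.trans[OF nab padic_norm_of_int_dvd[OF *]] padic_norm_of_int_not_dvd[of a, where ?'p='p]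
        card_gt_1[where ?'p='p] by simp
  qed
  then have "coprime b ?p"
    using prime_card_int[where ?'a='p] by (metis coprime_commute prime_imp_coprime)
  then obtain c where c: "[b * c = 1] (mod ?p)" using cong_solve_coprime_int by blast
  define h where "h = (?p - 1) div 2"
  have h: "?p = 2 * h + 1" using assms(1) by (auto simp: h_def elim!: oddE)
  define t where "t = (a * c + h) mod ?p"
  define d where "d = t - h"
  have "0 \<le> t" "t < ?p"
    unfolding t_def
    by (rule pos_mod_sign pos_mod_bound, simp)+
  then have d1: "2 * \<bar>d\<bar> < ?p" unfolding d_def h by arith
  have "[d = a * c] (mod ?p)" unfolding d_def t_def by (simp add: cong_def mod_simps)
  then have "[b * d = b * (a * c)] (mod ?p)" by (rule cong_scalar_left)
  also have "[b * (a * c) = a * 1] (mod ?p)" using cong_scalar_left[OF c, of a] by (simp add: ac_simps)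
  finally have "?p dvd a - b * d" by (simp add: cong_iff_dvd_diff dvd_diff_commute)
  then have *: "padic_norm (of_int (a - b * d) :: 'p padic) \<le> 1 / CARD('p)" by (rule padic_norm_of_int_dvd)
  have "of_rat q - of_int d = (of_int (a - b * d) / of_int b :: 'p padic)"
    using b by (simp add: rq field_simps)
  then have "padic_norm (of_rat q - of_int d :: 'p padic) \<le> 1 / CARD('p)"
    using * padic_norm_of_int_not_dvd[OF ndvd] by (simp add: padic_norm_divide)
  then have "padic_norm ((x - of_rat q) + (of_rat q - of_int d)) \<le> 1 / CARD('p)"
    by (intro padic_norm_add_le padic_norm_less_1[OF q])
  then show ?thesis using that[OF d1] by simp
qed

lemma browkin_expansion_exists:
  fixes \<alpha> :: "'p::prime_card padic"
  assumes odd: "odd CARD('p)"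
  shows "\<exists>x. browkin_expansion \<alpha> x"
proof -
  let ?p = "of_nat CARD('p) :: 'p padic"
  have p1: "real CARD('p) > 1" by (rule card_gt_1)
  have p0: "?p \<noteq> 0" by simp
  obtain k where k: "padic_norm (\<alpha> / ?p powi k) \<le> 1"
  proof (cases "\<alpha> = 0")
    case False
    then obtain l where "padic_norm \<alpha> = real CARD('p) powi l" by (rule padic_norm_cases)
    then have "padic_norm (\<alpha> / ?p powi (- l)) \<le> 1"
      using p1 by (simp add: padic_norm_divide padic_norm_card_powi)
    then show ?thesis by (rule that)
  qed (use that[of 0] in simp)
  define D where "D y = (SOME d. 2 * \<bar>d\<bar> < int CARD('p) \<and> padic_norm (y - of_int d) \<le> 1 / CARD('p))"
    for y :: "'p padic"
  have D: "2 * \<bar>D y\<bar> < int CARD('p)" "padic_norm (y - of_int (D y)) \<le> 1 / CARD('p)"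
    if "padic_norm y \<le> 1" for y
    using someI_ex[of "\<lambda>d. 2 * \<bar>d\<bar> < int CARD('p) \<and> padic_norm (y - of_int d) \<le> 1 / CARD('p)"]
      browkin_digit[OF odd that] unfolding D_def by blast+
  define r where "r = rec_nat (\<alpha> / ?p powi k) (\<lambda>_ y. (y - of_int (D y)) / ?p)"
  have r0: "r 0 = \<alpha> / ?p powi k" and rS: "r (Suc n) = (r n - of_int (D (r n))) / ?p" for n
    by (simp_all add: r_def)
  have pn: "padic_norm ?p = 1 / CARD('p)"
    using padic_norm_card_powi[of 1, where ?'p='p] by (simp add: power_int_minus inverse_eq_divide)
  have r1: "padic_norm (r n) \<le> 1" for n
  proof (induction n)
    case (Suc n)
    then show ?case using D(2)[OF Suc] p1 by (simp add: rS padic_norm_divide pn field_simps)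
  qed (use k r0 in simp)
  define x where "x j = (if j < k then 0 else D (r (nat (j - k))))" for j
  have xk: "x (k + int n) = D (r n)" for n by (simp add: x_def)
  have part: "(\<Sum>i<n. of_int (x (k + int i)) * ?p powi (k + int i)) = \<alpha> - ?p powi (k + int n) * r n" for n
  proof (induction n)
    case (Suc n)
    have "?p powi (k + int (Suc n)) = ?p powi (k + int n) * ?p"
      using power_int_add_1[of ?p "k + int n"] p0 by (simp add: ac_simps)
    then have "?p powi (k + int (Suc n)) * r (Suc n) = ?p powi (k + int n) * (r n - of_int (D (r n)))"
      using p0 unfolding rS by (simp add: field_simps)
    then have "\<alpha> - ?p powi (k + int (Suc n)) * r (Suc n)
        = (\<alpha> - ?p powi (k + int n) * r n) + of_int (D (r n)) * ?p powi (k + int n)"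
      by (simp only:) (simp add: algebra_simps)
    then show ?case using Suc by (simp only: sum.lessThan_Suc xk)
  qed (simp add: r0)
  have "(\<lambda>i. of_int (x (k + int i)) * ?p powi (k + int i)) sums \<alpha>"
    unfolding sums_def part
  proof (subst tendsto_dist_iff, rule tendsto_sandwich[OF _ _ tendsto_const])
    show "\<forall>\<^sub>F n in sequentially. dist (\<alpha> - ?p powi (k + int n) * r n) \<alpha> \<le> real CARD('p) powi (- k) * (1 / CARD('p)) ^ n"
    proof (intro always_eventually allI)
      fix n
      have "real CARD('p) powi (- (k + int n)) = real CARD('p) powi (- k) * (1 / CARD('p)) ^ n"
        using p1 by (simp add: power_int_diff power_one_over)
      then show "dist (\<alpha> - ?p powi (k + int n) * r n) \<alpha> \<le> real CARD('p) powi (- k) * (1 / CARD('p)) ^ n"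
        using mult_left_mono[OF r1[of n], of "real CARD('p) powi (- (k + int n))"]
        by (simp add: dist_padic_def padic_norm_mult padic_norm_card_powi)
    qed
    have "(\<lambda>n. (1 / real CARD('p)) ^ n) \<longlonglongrightarrow> 0" using p1 by (intro LIMSEQ_realpow_zero) auto
    then show "(\<lambda>n. real CARD('p) powi (- k) * (1 / CARD('p)) ^ n) \<longlonglongrightarrow> 0"
      by (rule tendsto_mult_right_zero)
  qed simp
  moreover have "2 * \<bar>x j\<bar> < int CARD('p)" for j
    using D(1)[OF r1] p1 by (auto simp: x_def)
  ultimately have "browkin_expansion \<alpha> x"
    unfolding browkin_expansion_def by (auto intro!: exI[of _ k] simp: x_def)
  then show ?thesis by blast
qed

lemma browkin_expansion_finite:
  assumes "browkin_expansion \<alpha> x"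
  shows "finite {i. i < j \<and> x i \<noteq> 0}"
proof -
  obtain k where "\<forall>j<k. x j = 0" using assms by (auto simp: browkin_expansion_def)
  then have "{i. i < j \<and> x i \<noteq> 0} \<subseteq> {k..<j}" by force
  then show ?thesis by (rule finite_subset) simp
qed

lemma browkin_expansion_approx:
  fixes \<alpha> :: "'p::prime_card padic"
  assumes "browkin_expansion \<alpha> x"
  shows "padic_norm (\<alpha> - (\<Sum>i | i < j \<and> x i \<noteq> 0. of_int (x i) * of_nat CARD('p) powi i))
    \<le> real CARD('p) powi (- j)"
proof -
  define c where "c i = (of_int (x i) * of_nat CARD('p) powi i :: 'p padic)" for i
  obtain k where k: "\<And>i. i < k \<Longrightarrow> x i = 0" and lim: "(\<lambda>n. \<Sum>i<n. c (k + int i)) \<longlonglongrightarrow> \<alpha>"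
    using assms by (auto simp: browkin_expansion_def c_def sums_def)
  have p1: "real CARD('p) > 1" by (rule card_gt_1)
  have "real CARD('p) powi (- j) > 0" using p1 by simp
  from tendstoD[OF lim this] obtain n0
    where n0: "\<And>n. n \<ge> n0 \<Longrightarrow> dist (\<Sum>i<n. c (k + int i)) \<alpha> < real CARD('p) powi (- j)"
    by (auto simp: eventually_sequentially)
  define n where "n = max n0 (nat (j - k))"
  have n: "n \<ge> n0" "j \<le> k + int n" by (auto simp: n_def)
  let ?A = "{k..<k + int n}"
  have S: "(\<Sum>i<n. c (k + int i)) = sum c ?A"
    by (rule sum.reindex_bij_witness[of _ "\<lambda>i. nat (i - k)" "\<lambda>i. k + int i"]) auto
  have "{i. i < j \<and> x i \<noteq> 0} \<subseteq> {i \<in> ?A. i < j}" using n k not_less by fastforce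
  moreover have "finite {i \<in> ?A. i < j}" by (rule finite_subset[of _ ?A]) auto
  ultimately have T: "(\<Sum>i | i < j \<and> x i \<noteq> 0. c i) = sum c {i \<in> ?A. i < j}"
    by (intro sum.mono_neutral_left) (auto simp: c_def)
  have "sum c ?A = sum c {i \<in> ?A. i < j} + sum c {i \<in> ?A. \<not> i < j}"
    using sum.Int_Diff[of ?A c "{..<j}"] by (simp add: Int_def set_diff_eq)
  then have "\<alpha> - (\<Sum>i | i < j \<and> x i \<noteq> 0. c i) = (\<alpha> - sum c ?A) + sum c {i \<in> ?A. \<not> i < j}"
    by (simp add: T)
  moreover have "padic_norm (\<alpha> - sum c ?A) \<le> real CARD('p) powi (- j)"
    using n0[OF n(1)] by (simp add: S dist_padic_def padic_norm_minus_commute)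
  moreover have "padic_norm (sum c {i \<in> ?A. \<not> i < j}) \<le> real CARD('p) powi (- j)"
  proof (rule padic_norm_sum_le)
    fix i assume "i \<in> {i \<in> ?A. \<not> i < j}"
    then have "real CARD('p) powi (- i) \<le> real CARD('p) powi (- j)"
      using p1 by (intro power_int_increasing) auto
    then show "padic_norm (c i) \<le> real CARD('p) powi (- j)"
      using mult_mono[OF padic_norm_of_int_le_1[of "x i", where ?'p='p], of "real CARD('p) powi (- i)" "real CARD('p) powi (- j)"]
      by (simp add: c_def padic_norm_mult padic_norm_card_powi)
  qed simp
  ultimately show ?thesis unfolding c_def[symmetric] by (simp only: padic_norm_add_le)
qed

lemma browkin_expansion_unique:
  fixes \<alpha> :: "'p::prime_card padic"
  assumes x: "browkin_expansion \<alpha> x" and y: "browkin_expansion \<alpha> y"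
  shows "x = y"
proof -
  let ?p = "of_nat CARD('p) :: 'p padic"
  have p1: "real CARD('p) > 1" by (rule card_gt_1)
  define T where "T z j = (\<Sum>i | i < j \<and> z i \<noteq> 0. of_int (z i) * ?p powi i)" for z j
  have TS: "T z (j + 1) = T z j + of_int (z j) * ?p powi j" if "browkin_expansion \<alpha> z" for z j
  proof (cases "z j = 0")
    case True
    then have "{i. i < j + 1 \<and> z i \<noteq> 0} = {i. i < j \<and> z i \<noteq> 0}" by (auto simp: le_less)
    with True show ?thesis by (simp add: T_def)
  next
    case False
    then have "{i. i < j + 1 \<and> z i \<noteq> 0} = insert j {i. i < j \<and> z i \<noteq> 0}" by auto
    then show ?thesis using browkin_expansion_finite[OF that] by (simp add: T_def add.commute)
  qed
  have step: "x j = y j" if eq: "\<And>i. i < j \<Longrightarrow> x i = y i" for j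
  proof (rule ccontr)
    assume ne: "x j \<noteq> y j"
    have "T x j = T y j" unfolding T_def by (rule sum.cong) (use eq in auto)
    then have "(\<alpha> - T y (j + 1)) - (\<alpha> - T x (j + 1)) = of_int (x j - y j) * ?p powi j"
      unfolding TS[OF x] TS[OF y] by (simp add: algebra_simps)
    moreover have "padic_norm ((\<alpha> - T y (j + 1)) - (\<alpha> - T x (j + 1))) \<le> real CARD('p) powi (- (j + 1))"
      using padic_norm_ultra_diff[of "\<alpha> - T y (j + 1)" "\<alpha> - T x (j + 1)"]
        browkin_expansion_approx[OF x, of "j + 1"] browkin_expansion_approx[OF y, of "j + 1"]
      unfolding T_def by linarith
    moreover have "\<not> int CARD('p) dvd x j - y j"
    proof
      assume "int CARD('p) dvd x j - y j"
      then have "int CARD('p) \<le> \<bar>x j - y j\<bar>" using ne dvd_imp_le_int[of "x j - y j" "int CARD('p)"] by simp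
      moreover have "2 * \<bar>x j\<bar> < int CARD('p)" "2 * \<bar>y j\<bar> < int CARD('p)"
        using x y by (auto simp: browkin_expansion_def)
      ultimately show False by linarith
    qed
    ultimately have "real CARD('p) powi (- j) \<le> real CARD('p) powi (- (j + 1))"
      by (simp add: padic_norm_mult padic_norm_card_powi padic_norm_of_int_not_dvd del: of_int_diff)
    moreover have "real CARD('p) powi (- (j + 1)) < real CARD('p) powi (- j)"
      using p1 by (intro power_int_strict_increasing) auto
    ultimately show False by simp
  qed
  obtain k l where kl: "\<And>i. i < k \<Longrightarrow> x i = 0" "\<And>i. i < l \<Longrightarrow> y i = 0"
    using x y unfolding browkin_expansion_def by blast
  have *: "\<forall>i < min k l + int n. x i = y i" for n
  proof (induction n)
    case (Suc n)
    then have "x (min k l + int n) = y (min k l + int n)" using step by blast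
    moreover have "i < min k l + int n \<or> i = min k l + int n" if "i < min k l + int (Suc n)" for i
      using that by linarith
    ultimately show ?case using Suc by metis
  qed (use kl in auto)
  show ?thesis
  proof
    fix i
    have "i < min k l + int (nat (i - min k l) + 1)" by linarith
    with * show "x i = y i" by blast
  qed
qed

lemma browkin_expansion_ex1:
  "odd CARD('p) \<Longrightarrow> \<exists>!x. browkin_expansion (\<alpha> :: 'p::prime_card padic) x"
  using browkin_expansion_exists browkin_expansion_unique by blast

definition browkin_s :: "'p::prime_card padic \<Rightarrow> rat" where
  "browkin_s \<alpha> = (let x = THE x. browkin_expansion \<alpha> x in
     \<Sum>j | j \<le> 0 \<and> x j \<noteq> 0. of_int (x j) * of_nat CARD('p) powi j)"

lemma of_rat_power_int: "(of_rat (q powi k) :: 'a::field_char_0) = of_rat q powi k"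
  by (simp add: power_int_def of_rat_power of_rat_inverse)

lemma browkin_s_close:
  fixes \<alpha> :: "'p::prime_card padic"
  assumes "odd CARD('p)"
  shows "padic_norm (\<alpha> - of_rat (browkin_s \<alpha>)) \<le> 1 / CARD('p)"
proof -
  define x where "x = (THE x. browkin_expansion \<alpha> x)"
  have x: "browkin_expansion \<alpha> x"
    unfolding x_def by (rule theI'[OF browkin_expansion_ex1[OF assms]])
  have "{j. j \<le> 0 \<and> x j \<noteq> 0} = {i. i < 1 \<and> x i \<noteq> 0}" by auto
  then have "(of_rat (browkin_s \<alpha>) :: 'p padic) = (\<Sum>i | i < 1 \<and> x i \<noteq> 0. of_int (x i) * of_nat CARD('p) powi i)"
    unfolding browkin_s_def x_def[symmetric] Let_def by (simp add: of_rat_sum of_rat_mult of_rat_power_int)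
  then show ?thesis
    using browkin_expansion_approx[OF x, of 1] by (simp add: power_int_minus inverse_eq_divide)
qed

section \<open>The p-adic Jacobi--Perron algorithm\<close>

text \<open>Vectors of dimension \<open>m\<close> are functions restricted to \<open>{1..m}\<close>; the values at other indices are
  irrelevant. After a stop, \<open>jp_complete\<close> continues with meaningless values (division by \<open>0\<close>).\<close>

primrec jp_complete :: "nat \<Rightarrow> (nat \<Rightarrow> 'p::prime_card padic) \<Rightarrow> nat \<Rightarrow> nat \<Rightarrow> 'p padic" where
  "jp_complete m \<alpha> 0 = \<alpha>"
| "jp_complete m \<alpha> (Suc n) =
     (let \<beta> = jp_complete m \<alpha> n; a = (\<lambda>i. of_rat (browkin_s (\<beta> i))) in
      (\<lambda>i. if i = 1 then 1 / (\<beta> m - a m) else (\<beta> (i - 1) - a (i - 1)) / (\<beta> m - a m)))"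

definition jp_partial :: "nat \<Rightarrow> (nat \<Rightarrow> 'p::prime_card padic) \<Rightarrow> nat \<Rightarrow> nat \<Rightarrow> rat" where
  "jp_partial m \<alpha> n i = browkin_s (jp_complete m \<alpha> n i)"

definition jp_never_stops :: "nat \<Rightarrow> (nat \<Rightarrow> 'p::prime_card padic) \<Rightarrow> bool" where
  "jp_never_stops m \<alpha> \<longleftrightarrow> (\<forall>n. jp_complete m \<alpha> n m \<noteq> of_rat (jp_partial m \<alpha> n m))"

definition purely_periodic_mcf :: "nat \<Rightarrow> (nat \<Rightarrow> 'p::prime_card padic) \<Rightarrow> nat \<Rightarrow> bool" where
  "purely_periodic_mcf m \<alpha> N \<longleftrightarrow> jp_never_stops m \<alpha> \<and>
     (\<forall>k. \<forall>i\<in>{1..m}. jp_partial m \<alpha> (k + N) i = jp_partial m \<alpha> k i)"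

text \<open>Matrix indices start from \<open>0\<close>, the indices of the partial quotients from \<open>1\<close>.\<close>

definition mcf_matrix :: "nat \<Rightarrow> (nat \<Rightarrow> 'p::prime_card padic) \<Rightarrow> nat \<Rightarrow> rat mat" where
  "mcf_matrix m \<alpha> n = mat (m + 1) (m + 1) (\<lambda>(i, j).
     if j = 0 then (if i < m then jp_partial m \<alpha> n (i + 1) else 1)
     else if j = i + 1 then 1 else 0)"

primrec mcf_matrix_prod :: "nat \<Rightarrow> (nat \<Rightarrow> 'p::prime_card padic) \<Rightarrow> nat \<Rightarrow> rat mat" where
  "mcf_matrix_prod m \<alpha> 0 = 1\<^sub>m (m + 1)"
| "mcf_matrix_prod m \<alpha> (Suc n) = mcf_matrix_prod m \<alpha> n * mcf_matrix m \<alpha> n"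

definition mcf_char_poly :: "nat \<Rightarrow> (nat \<Rightarrow> 'p::prime_card padic) \<Rightarrow> nat \<Rightarrow> rat poly" where
  "mcf_char_poly m \<alpha> N = char_poly (mcf_matrix_prod m \<alpha> N)"

text \<open>Only the roots in \<open>\<rat>\<^sub>p\<close> are compared.\<close>

definition is_greatest_root :: "rat poly \<Rightarrow> 'p::prime_card padic \<Rightarrow> bool" where
  "is_greatest_root P \<mu> \<longleftrightarrow> poly (map_poly of_rat P) \<mu> = 0 \<and>
     (\<forall>\<nu>. poly (map_poly of_rat P) \<nu> = 0 \<and> \<nu> \<noteq> \<mu> \<longrightarrow> padic_norm \<nu> < padic_norm \<mu>)"

locale periodic_mcf =
  fixes \<alpha> :: "nat \<Rightarrow> 'p::prime_card padic" and m N :: nat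
  assumes odd: "odd CARD('p)" and m: "m \<ge> 1" and N: "N \<ge> 1"
    and periodic: "purely_periodic_mcf m \<alpha> N"
begin

abbreviation "\<beta> \<equiv> jp_complete m \<alpha>"
abbreviation "a n i \<equiv> (of_rat (jp_partial m \<alpha> n i) :: 'p padic)"

lemma q1: "real CARD('p) > 1" by (rule card_gt_1)

lemma inverse_card_less: "1 / real CARD('p) < real CARD('p)"
  using q1 less_1_mult[OF q1 q1] by (simp add: divide_less_eq)

lemma close: "padic_norm (\<beta> n i - a n i) \<le> 1 / real CARD('p)"
  unfolding jp_partial_def by (rule browkin_s_close[OF odd])

lemma nonstop: "\<beta> n m - a n m \<noteq> 0"
  using periodic by (auto simp: purely_periodic_mcf_def jp_never_stops_def)

lemma partial_periodic: "i \<in> {1..m} \<Longrightarrow> a (n + N) i = a n i"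
  using periodic by (auto simp: purely_periodic_mcf_def)

lemma beta_Suc_1: "\<beta> (Suc n) 1 = 1 / (\<beta> n m - a n m)"
  and beta_Suc: "(i::nat) \<ge> 1 \<Longrightarrow> \<beta> (Suc n) (i + 1) = (\<beta> n i - a n i) * \<beta> (Suc n) 1"
  by (simp_all add: Let_def jp_partial_def)

lemma beta_Suc_1_ge: "padic_norm (\<beta> (Suc n) 1) \<ge> real CARD('p)"
proof -
  have "padic_norm (\<beta> n m - a n m) > 0" using nonstop by simp
  then show ?thesis using close[of n m] q1
    unfolding beta_Suc_1 by (simp add: padic_norm_divide field_simps)
qed

lemma norm_beta_Suc_le: "i \<in> {1..m} \<Longrightarrow> padic_norm (\<beta> (Suc n) i) \<le> padic_norm (\<beta> (Suc n) 1)"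
proof (cases "i = 1")
  case False
  assume "i \<in> {1..m}"
  with False have j: "i = (i - 1) + 1" "i - 1 \<ge> 1" by auto
  have "padic_norm (\<beta> n (i - 1) - a n (i - 1)) \<le> 1" using close[of n "i - 1"] q1 by (auto intro: order.trans)
  then show ?thesis unfolding beta_Suc[OF j(2), unfolded j(1)[symmetric]] padic_norm_mult
    by (intro mult_left_le_one_le) auto
qed simp

lemma norm_a_eq: "padic_norm (\<beta> n 1) \<ge> real CARD('p) \<Longrightarrow> padic_norm (a n 1) = padic_norm (\<beta> n 1)"
proof (rule padic_norm_eq_close)
  assume *: "real CARD('p) \<le> padic_norm (\<beta> n 1)"
  have "1 / real CARD('p) < real CARD('p)" by (rule inverse_card_less)
  then show "padic_norm (\<beta> n 1 - a n 1) < padic_norm (\<beta> n 1)"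
    using close[of n 1] * by linarith
qed

lemma norm_a_Suc_le: "i \<in> {1..m} \<Longrightarrow> padic_norm (a (Suc n) i) \<le> padic_norm (\<beta> (Suc n) 1)"
proof -
  assume "i \<in> {1..m}"
  moreover have "1 / real CARD('p) \<le> real CARD('p)" using inverse_card_less by (rule less_imp_le)
  ultimately have "padic_norm (\<beta> (Suc n) i - (\<beta> (Suc n) i - a (Suc n) i)) \<le> padic_norm (\<beta> (Suc n) 1)"
    using norm_beta_Suc_le[of i n] close[of "Suc n" i] beta_Suc_1_ge[of n]
      padic_norm_ultra_diff[of "\<beta> (Suc n) i" "\<beta> (Suc n) i - a (Suc n) i"] by linarith
  then show ?thesis by simp
qed

definition "v n i = (if i \<le> m then \<beta> n i else if i = m + 1 then 1 else 0)"
definition "a1 n i = (if i \<le> m then a n i else if i = m + 1 then 1 else 0)"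

lemma v_step:
  assumes "i \<in> {1..m + 1}"
  shows "a1 n i * v (Suc n) 1 + v (Suc n) (i + 1) = v (Suc n) 1 * v n i"
proof -
  have v1: "v (Suc n) 1 = \<beta> (Suc n) 1" using m by (simp add: v_def)
  have nz: "(\<beta> n m - a n m) * \<beta> (Suc n) 1 = 1" using nonstop[of n] unfolding beta_Suc_1 by simp
  consider "i < m" | "i = m" | "i = m + 1" using assms by force
  then show ?thesis
  proof cases
    case 1
    then have "v (Suc n) (i + 1) = (\<beta> n i - a n i) * \<beta> (Suc n) 1"
      using beta_Suc[of i n] assms by (simp add: v_def del: jp_complete.simps)
    then show ?thesis unfolding v1 using 1 by (simp add: v_def a1_def algebra_simps del: jp_complete.simps)
  next
    case 2
    then have "v (Suc n) (i + 1) = (\<beta> n m - a n m) * \<beta> (Suc n) 1"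
      unfolding nz by (simp add: v_def)
    then show ?thesis unfolding v1 using 2 by (simp add: v_def a1_def algebra_simps del: jp_complete.simps)
  next
    case 3
    then show ?thesis unfolding v1 by (simp add: v_def a1_def del: jp_complete.simps)
  qed
qed

lemma v1_ne: "v (Suc n) 1 \<noteq> 0"
proof -
  have "padic_norm (\<beta> (Suc n) 1) > 0" using beta_Suc_1_ge[of n] q1 by linarith
  then show ?thesis using m by (simp add: v_def del: jp_complete.simps)
qed

lemma a1_periodic: "i \<ge> 1 \<Longrightarrow> a1 (n + N) i = a1 n i"
  using partial_periodic[of i n] by (simp add: a1_def)

lemma norm_v1_periodic: "padic_norm (v (Suc n + N) 1) = padic_norm (v (Suc n) 1)"
  using norm_a_eq[OF beta_Suc_1_ge[of n]] norm_a_eq[OF beta_Suc_1_ge[of "n + N"]] m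
    partial_periodic[of 1 "Suc n"] by (simp add: v_def del: jp_complete.simps)

lemma norm_v_le: "padic_norm (v (Suc n) i) \<le> padic_norm (v (Suc n) 1)"  if "i \<ge> 1"
  using norm_beta_Suc_le[of i n] beta_Suc_1_ge[of n] q1 m that
  by (simp add: v_def del: jp_complete.simps)

lemma norm_a1_le: "padic_norm (a1 (Suc n) i) \<le> padic_norm (v (Suc n) 1)"  if "i \<ge> 1"
  using norm_a_Suc_le[of i n] beta_Suc_1_ge[of n] q1 m that
  by (simp add: v_def a1_def del: jp_complete.simps)

text \<open>The minors of \<open>v n\<close> and \<open>v (n + N)\<close> are contracted by each step, hence vanish.\<close>

definition "minor n i j = v n i * v (n + N) j - v n j * v (n + N) i"

lemma minor_step:
  assumes "i \<in> {1..m + 1}" "j \<in> {1..m + 1}"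
  shows "minor n i j * (v (Suc n) 1 * v (Suc n + N) 1)
    = a1 n i * minor (Suc n) 1 (j + 1) + a1 n j * minor (Suc n) (i + 1) 1 + minor (Suc n) (i + 1) (j + 1)"
proof -
  let ?x = "v (Suc n)" and ?y = "v (Suc n + N)"
  have "minor n i j * (?x 1 * ?y 1) = (?x 1 * v n i) * (?y 1 * v (n + N) j) - (?x 1 * v n j) * (?y 1 * v (n + N) i)"
    by (simp add: minor_def algebra_simps)
  also have "\<dots> = (a1 n i * ?x 1 + ?x (i + 1)) * (a1 n j * ?y 1 + ?y (j + 1))
      - (a1 n j * ?x 1 + ?x (j + 1)) * (a1 n i * ?y 1 + ?y (i + 1))"
    using v_step[OF assms(1), of n] v_step[OF assms(2), of n] v_step[OF assms(1), of "n + N"]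
      v_step[OF assms(2), of "n + N"] a1_periodic[of i n] a1_periodic[of j n] assms by simp
  also have "\<dots> = a1 n i * minor (Suc n) 1 (j + 1) + a1 n j * minor (Suc n) (i + 1) 1 + minor (Suc n) (i + 1) (j + 1)"
    by (simp add: minor_def algebra_simps)
  finally show ?thesis .
qed

lemma minor_bound:
  assumes "i \<ge> 1" "j \<ge> 1"
  shows "padic_norm (minor (Suc n) i j) \<le> padic_norm (v (Suc n) 1) ^ 2 * (1 / real CARD('p)) ^ K"
  using assms
proof (induction K arbitrary: n i j)
  case 0
  let ?V = "padic_norm (v (Suc n) 1)"
  have "padic_norm (v (Suc n) i * v (Suc n + N) j) \<le> ?V * ?V"
    if "i \<ge> 1" "j \<ge> 1" for i j
    using norm_v_le[of i n] norm_v_le[of j "n + N"] norm_v1_periodic[of n] that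
    unfolding padic_norm_mult by (intro mult_mono) auto
  from this[of i j] this[of j i] 0
  have "padic_norm (v (Suc n) i * v (Suc n + N) j - v (Suc n) j * v (Suc n + N) i) \<le> ?V * ?V"
    by (intro order.trans[OF padic_norm_ultra_diff] max.boundedI) auto
  then show ?case unfolding minor_def by (simp add: power2_eq_square)
next
  case (Suc K)
  let ?V = "padic_norm (v (Suc n) 1)" and ?W = "padic_norm (v (Suc (Suc n)) 1)"
  have V: "?V \<ge> real CARD('p)" and W: "?W \<ge> real CARD('p)"
    using beta_Suc_1_ge[of n] beta_Suc_1_ge[of "Suc n"] m by (simp_all add: v_def del: jp_complete.simps)
  show ?case
  proof (cases "i \<le> m + 1 \<and> j \<le> m + 1")
    case False
    then have "minor (Suc n) i j = 0" by (auto simp: minor_def v_def)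
    then show ?thesis by simp
  next
    case True
    let ?C = "?V * (?W ^ 2 * (1 / real CARD('p)) ^ K)"
    have b: "padic_norm (x * minor (Suc (Suc n)) k l) \<le> ?C"
      if "padic_norm x \<le> ?V" "k \<ge> 1" "l \<ge> 1" for x k l
      using Suc.IH[of k l "Suc n"] that unfolding padic_norm_mult by (intro mult_mono) auto
    have "padic_norm (minor (Suc n) i j * (v (Suc (Suc n)) 1 * v (Suc (Suc n) + N) 1)) \<le> ?C"
      unfolding minor_step[of i j "Suc n", OF atLeastAtMost_iff[THEN iffD2] atLeastAtMost_iff[THEN iffD2],
        OF conjI conjI, OF Suc.prems(1) True[THEN conjunct1] Suc.prems(2) True[THEN conjunct2]]
      using b[of "a1 (Suc n) i" 1 "j + 1"] b[of "a1 (Suc n) j" "i + 1" 1] b[of 1 "i + 1" "j + 1"]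
        norm_a1_le[of i n] norm_a1_le[of j n] Suc.prems V q1
      by (intro padic_norm_add_le) auto
    then have "padic_norm (minor (Suc n) i j) * ?W ^ 2 \<le> (?V * (1 / real CARD('p)) ^ K) * ?W ^ 2"
      using norm_v1_periodic[of "Suc n"] by (simp add: padic_norm_mult power2_eq_square ac_simps)
    moreover have "?W ^ 2 > 0" using less_le_trans[OF q1 W] by (intro zero_less_power) linarith
    ultimately have 1: "padic_norm (minor (Suc n) i j) \<le> ?V * (1 / real CARD('p)) ^ K"
      by (simp only: mult_le_cancel_right_pos)
    have "?V * 1 \<le> ?V * (?V * (1 / real CARD('p)))"
      using V q1 by (intro mult_left_mono) (auto simp: field_simps)
    then have "?V * (1 / real CARD('p)) ^ K \<le> ?V ^ 2 * (1 / real CARD('p)) ^ Suc K"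
      using mult_right_mono[of "?V * 1" "?V * (?V * (1 / real CARD('p)))" "(1 / real CARD('p)) ^ K"] q1
      by (simp add: power2_eq_square ac_simps)
    with 1 show ?thesis by linarith
  qed
qed

lemma v_Suc_periodic: "v (Suc n + N) i = v (Suc n) i" if "i \<ge> 1"
proof -
  have "padic_norm (minor (Suc n) i (m + 1)) \<le> 0"
  proof (rule LIMSEQ_le_const)
    have "(\<lambda>K. (1 / real CARD('p)) ^ K) \<longlonglongrightarrow> 0" using q1 by (intro LIMSEQ_realpow_zero) auto
    then show "(\<lambda>K. padic_norm (v (Suc n) 1) ^ 2 * (1 / real CARD('p)) ^ K) \<longlonglongrightarrow> 0"
      by (rule tendsto_mult_right_zero)
    show "\<exists>M. \<forall>K\<ge>M. padic_norm (minor (Suc n) i (m + 1)) \<le> padic_norm (v (Suc n) 1) ^ 2 * (1 / real CARD('p)) ^ K"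
      using minor_bound[of i "m + 1" n] that by auto
  qed
  then have "minor (Suc n) i (m + 1) = 0" using padic_norm_nonneg[of "minor (Suc n) i (m + 1)"]
    by (metis order_antisym padic_norm_eq_0)
  then show ?thesis by (simp add: minor_def v_def del: jp_complete.simps)
qed

lemma v_periodic: "v (n + N) i = v n i" if "i \<in> {1..m + 1}"
proof -
  have "v (Suc n) 1 * v (n + N) i = a1 (n + N) i * v (Suc n + N) 1 + v (Suc n + N) (i + 1)"
    using v_step[OF that, of "n + N"] v_Suc_periodic[of 1 n] by (metis add_Suc order_refl)
  also have "\<dots> = a1 n i * v (Suc n) 1 + v (Suc n) (i + 1)"
    using that by (simp only: v_Suc_periodic a1_periodic atLeastAtMost_iff le_add2 order_refl)
  also have "\<dots> = v (Suc n) 1 * v n i" by (rule v_step[OF that])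
  finally have "v (Suc n) 1 * v (n + N) i = v (Suc n) 1 * v n i" .
  then show ?thesis using v1_ne[of n] mult_left_cancel by blast
qed

lemma norm_v1_ge: "padic_norm (v n 1) \<ge> real CARD('p)"
proof -
  obtain k where "n + N = Suc k" using N by (cases "n + N") auto
  then have "padic_norm (v (n + N) 1) \<ge> real CARD('p)" using beta_Suc_1_ge[of k] m by (simp add: v_def)
  then show ?thesis using v_periodic[of 1 n] by simp
qed

definition A :: "nat \<Rightarrow> 'p padic mat" where "A n = map_mat of_rat (mcf_matrix m \<alpha> n)"
definition M :: "nat \<Rightarrow> 'p padic mat" where "M n = map_mat of_rat (mcf_matrix_prod m \<alpha> n)"
definition "w n = vec (m + 1) (\<lambda>i. v n (i + 1))"

lemma matrix_carrier: "mcf_matrix m \<alpha> n \<in> carrier_mat (m + 1) (m + 1)"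
  by (simp add: mcf_matrix_def)

lemma prod_carrier: "mcf_matrix_prod m \<alpha> n \<in> carrier_mat (m + 1) (m + 1)"
proof (induction n)
  case (Suc n)
  then show ?case unfolding mcf_matrix_prod.simps using matrix_carrier by (rule mult_carrier_mat)
qed simp

lemma A_carrier: "A n \<in> carrier_mat (m + 1) (m + 1)"
  unfolding A_def using matrix_carrier by simp

lemma M_carrier: "M n \<in> carrier_mat (m + 1) (m + 1)"
  using prod_carrier by (simp add: M_def)

lemma w_carrier: "w n \<in> carrier_vec (m + 1)"
  by (simp add: w_def)

lemma M_0: "M 0 = 1\<^sub>m (m + 1)"
  by (rule eq_matI) (auto simp: M_def)

interpretation of_rat_hom: field_hom "of_rat :: rat \<Rightarrow> 'p padic"
  by standard (auto simp: of_rat_add of_rat_mult)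

lemma M_Suc: "M (Suc n) = M n * A n"
  unfolding M_def A_def mcf_matrix_prod.simps
  by (rule of_rat_hom.mat_hom_mult[OF prod_carrier matrix_carrier])

lemma A_index: "i < m + 1 \<Longrightarrow> j < m + 1 \<Longrightarrow>
    A n $$ (i, j) = (if j = 0 then a1 n (i + 1) else if j = i + 1 then 1 else 0)"
  by (auto simp: A_def mcf_matrix_def a1_def)

lemma A_w: "A n *\<^sub>v w (Suc n) = v (Suc n) 1 \<cdot>\<^sub>v w n"
proof (rule eq_vecI)
  fix i assume "i < dim_vec (v (Suc n) 1 \<cdot>\<^sub>v w n)"
  then have i: "i < m + 1" by (simp add: w_def)
  have "(A n *\<^sub>v w (Suc n)) $ i = (\<Sum>j<m + 1. (if j = 0 then a1 n (i + 1) else if j = i + 1 then 1 else 0) * v (Suc n) (j + 1))"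
  proof -
    have "(A n *\<^sub>v w (Suc n)) $ i = row (A n) i \<bullet> w (Suc n)"
      using i carrier_matD[OF A_carrier[of n]] by (intro index_mult_mat_vec) simp
    also have "\<dots> = (\<Sum>j\<in>{0..<m + 1}. A n $$ (i, j) * v (Suc n) (j + 1))"
      unfolding scalar_prod_def using i carrier_matD[OF A_carrier[of n]] by (intro sum.cong) (auto simp: w_def)
    finally show ?thesis
      unfolding atLeast0LessThan using i A_index by (auto intro!: sum.cong simp del: sum.lessThan_Suc)
  qed
  also have "\<dots> = (\<Sum>j<m + 1. (if j = 0 then a1 n (i + 1) * v (Suc n) 1 else 0)
      + (if j = i + 1 then v (Suc n) (i + 2) else 0))"
    by (rule sum.cong) auto
  also have "\<dots> = a1 n (i + 1) * v (Suc n) 1 + (if i + 1 < m + 1 then v (Suc n) (i + 2) else 0)"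
    unfolding sum.distrib by (simp add: sum.delta)
  also have "(if i + 1 < m + 1 then v (Suc n) (i + 2) else 0) = v (Suc n) (i + 1 + 1)"
    using i by (auto simp: v_def)
  also have "a1 n (i + 1) * v (Suc n) 1 + v (Suc n) (i + 1 + 1) = v (Suc n) 1 * v n (i + 1)"
    by (rule v_step) (use i in auto)
  finally show "(A n *\<^sub>v w (Suc n)) $ i = (v (Suc n) 1 \<cdot>\<^sub>v w n) $ i"
    using i by (simp add: w_def)
qed (use A_carrier[of n] in \<open>simp add: w_def\<close>)

lemma M_w: "M n *\<^sub>v w n = (\<Prod>k<n. v (Suc k) 1) \<cdot>\<^sub>v w 0"
proof (induction n)
  case 0
  then show ?case using w_carrier[of 0] by (simp add: M_0)
next
  case (Suc n)
  have "M (Suc n) *\<^sub>v w (Suc n) = M n *\<^sub>v (A n *\<^sub>v w (Suc n))"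
    unfolding M_Suc by (rule assoc_mult_mat_vec[OF M_carrier A_carrier w_carrier])
  also have "\<dots> = v (Suc n) 1 \<cdot>\<^sub>v (M n *\<^sub>v w n)"
    unfolding A_w by (rule mult_mat_vec[OF M_carrier w_carrier])
  finally show ?case unfolding Suc by (simp add: smult_smult_assoc ac_simps)
qed

definition "\<mu> = (\<Prod>n<N. \<beta> n 1)"

lemma w_periodic: "w (n + N) = w n"
  by (rule eq_vecI) (auto simp: w_def v_periodic)

lemma mu_eq: "(\<Prod>k<N. v (Suc k) 1) = \<mu>"
proof -
  have "v N 1 = v 0 1" using v_periodic[of 1 0] by simp
  moreover have "v 0 1 * (\<Prod>k<n. v (Suc k) 1) = (\<Prod>k<n. v k 1) * v n 1" for n
    by (induction n) (auto simp: ac_simps)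
  moreover have "v 0 1 \<noteq> 0" using norm_v1_ge[of 0] q1 by auto
  ultimately have "(\<Prod>k<N. v (Suc k) 1) = (\<Prod>k<N. v k 1)" by (metis mult.commute mult_cancel_left)
  then show ?thesis using m by (simp add: \<mu>_def v_def del: jp_complete.simps)
qed

lemma M_w_mu: "M N *\<^sub>v w 0 = \<mu> \<cdot>\<^sub>v w 0"
  using M_w[of N] w_periodic[of 0] unfolding mu_eq by simp

lemma norm_mu: "padic_norm \<mu> > 1"
proof -
  have "padic_norm \<mu> = (\<Prod>k<N. padic_norm (v (Suc k) 1))" by (simp flip: mu_eq add: padic_norm_prod)
  also have "\<dots> > 1"
    by (intro less_1_prod) (use N less_le_trans[OF q1 norm_v1_ge] in \<open>auto simp: lessThan_empty_iff\<close>)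
  finally show ?thesis .
qed

lemma poly_root_iff: "poly (map_poly of_rat (mcf_char_poly m \<alpha> N)) x = 0 \<longleftrightarrow> eigenvalue (M N) x"
  unfolding mcf_char_poly_def of_rat_hom.char_poly_hom[OF prod_carrier, symmetric]
    M_def[symmetric] eigenvalue_root_char_poly[OF M_carrier] ..

lemma left_step:
  assumes u: "u \<in> carrier_vec (m + 1)" and orth: "u \<bullet> w n = 0"
    and B: "\<And>i. i < m + 1 \<Longrightarrow> padic_norm (u $ i) \<le> B" and B0: "B \<ge> 0"
  defines "u' \<equiv> (A n)\<^sup>T *\<^sub>v u"
  shows "u' \<in> carrier_vec (m + 1)" "u' \<bullet> w (Suc n) = 0" "\<And>i. i < m + 1 \<Longrightarrow> padic_norm (u' $ i) \<le> B"
proof -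
  have AT: "(A n)\<^sup>T \<in> carrier_mat (m + 1) (m + 1)" using A_carrier by simp
  then show u'c: "u' \<in> carrier_vec (m + 1)" unfolding u'_def using u by (rule mult_mat_vec_carrier)
  have "u' \<bullet> w (Suc n) = u \<bullet> (A n *\<^sub>v w (Suc n))"
    unfolding u'_def using transpose_vec_mult_scalar[OF A_carrier[of n] w_carrier[of "Suc n"] u] .
  then show "u' \<bullet> w (Suc n) = 0" using orth u w_carrier by (simp add: A_w)
  fix i assume i: "i < m + 1"
  have u'i: "u' $ i = (\<Sum>j<m + 1. (if i = 0 then a1 n (j + 1) else if i = j + 1 then 1 else 0) * u $ j)"
  proof -
    have "u' $ i = row ((A n)\<^sup>T) i \<bullet> u"
      unfolding u'_def using i carrier_matD[OF A_carrier[of n]] by (intro index_mult_mat_vec) simp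
    also have "\<dots> = (\<Sum>j\<in>{0..<m + 1}. A n $$ (j, i) * u $ j)"
      unfolding scalar_prod_def using i carrier_matD[OF A_carrier[of n]] carrier_vecD[OF u] by (intro sum.cong) auto
    finally show ?thesis
      unfolding atLeast0LessThan using i A_index by (auto intro!: sum.cong simp del: sum.lessThan_Suc)
  qed
  show "padic_norm (u' $ i) \<le> B"
  proof (cases i)
    case 0
    have "(\<Sum>j<m + 1. u $ j * v n (j + 1)) = 0"
      using orth u by (simp add: scalar_prod_def w_def atLeast0LessThan)
    then have "u' $ i = (\<Sum>j<m + 1. a1 n (j + 1) * u $ j) - (\<Sum>j<m + 1. u $ j * v n (j + 1))"
      using u'i 0 by simp
    also have "\<dots> = (\<Sum>j<m + 1. (a1 n (j + 1) - v n (j + 1)) * u $ j)"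
      unfolding sum_subtractf[symmetric] by (rule sum.cong) (simp_all add: algebra_simps)
    finally have *: "u' $ i = (\<Sum>j<m + 1. (a1 n (j + 1) - v n (j + 1)) * u $ j)" .
    show ?thesis unfolding *
    proof (rule padic_norm_sum_le[OF _ B0])
      fix j assume "j \<in> {..<m + 1}"
      moreover have "padic_norm (a1 n (j + 1) - v n (j + 1)) \<le> 1"
        using close[of n "j + 1"] q1
        by (auto simp: a1_def v_def padic_norm_minus_commute[of "a n _"] intro: order.trans)
      ultimately show "padic_norm ((a1 n (j + 1) - v n (j + 1)) * u $ j) \<le> B"
        using mult_mono[of "padic_norm (a1 n (j + 1) - v n (j + 1))" 1 "padic_norm (u $ j)" B] B[of j]
        by (simp add: padic_norm_mult)
    qed
  next
    case (Suc k)
    then have "u' $ i = (\<Sum>j<m + 1. if j = k then u $ k else 0)"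
      unfolding u'i by (intro sum.cong) auto
    then have "u' $ i = u $ k" using i Suc by simp
    then show ?thesis using B[of k] i Suc by simp
  qed
qed

lemma other_roots:
  assumes "eigenvalue (M N) \<nu>" "\<nu> \<noteq> \<mu>"
  shows "padic_norm \<nu> \<le> 1"
proof -
  have MT: "(M n)\<^sup>T \<in> carrier_mat (m + 1) (m + 1)" for n using M_carrier by simp
  have "eigenvalue ((M N)\<^sup>T) \<nu>"
    using assms(1) unfolding eigenvalue_root_char_poly[OF M_carrier] eigenvalue_root_char_poly[OF MT]
      char_poly_transpose_mat[OF M_carrier] .
  then obtain u where u: "u \<in> carrier_vec (m + 1)" "u \<noteq> 0\<^sub>v (m + 1)" "(M N)\<^sup>T *\<^sub>v u = \<nu> \<cdot>\<^sub>v u"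
    using M_carrier[of N] by (auto simp: eigenvalue_def eigenvector_def)
  have "((M N)\<^sup>T *\<^sub>v u) \<bullet> w 0 = u \<bullet> (M N *\<^sub>v w 0)"
    by (rule transpose_vec_mult_scalar[OF M_carrier w_carrier u(1)])
  then have "\<nu> * (u \<bullet> w 0) = \<mu> * (u \<bullet> w 0)"
    unfolding u(3) M_w_mu using u(1) w_carrier[of 0] by simp
  then have orth: "u \<bullet> w 0 = 0" using assms(2) by simp
  define B where "B = Max ((\<lambda>i. padic_norm (u $ i)) ` {..<m + 1})"
  have B: "padic_norm (u $ i) \<le> B" if "i < m + 1" for i
    unfolding B_def using that by (intro Max_ge) auto
  have "B \<in> (\<lambda>i. padic_norm (u $ i)) ` {..<m + 1}" unfolding B_def by (intro Max_in) auto
  then obtain i0 where i0: "i0 < m + 1" "B = padic_norm (u $ i0)" by auto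
  have "B > 0"
  proof (rule ccontr)
    assume "\<not> B > 0"
    then have "u $ i = 0" if "i < m + 1" for i
      using B[OF that] padic_norm_pos[of "u $ i"] by linarith
    then have "u = 0\<^sub>v (m + 1)" using u(1) by (intro eq_vecI) auto
    with u(2) show False by simp
  qed
  have "(M n)\<^sup>T *\<^sub>v u \<in> carrier_vec (m + 1) \<and> ((M n)\<^sup>T *\<^sub>v u) \<bullet> w n = 0 \<and>
      (\<forall>i<m + 1. padic_norm (((M n)\<^sup>T *\<^sub>v u) $ i) \<le> B)" for n
  proof (induction n)
    case 0
    then show ?case using u(1) orth B by (simp add: M_0)
  next
    case (Suc n)
    have "(M (Suc n))\<^sup>T *\<^sub>v u = (A n)\<^sup>T *\<^sub>v ((M n)\<^sup>T *\<^sub>v u)"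
      unfolding M_Suc transpose_mult[OF M_carrier A_carrier]
      by (rule assoc_mult_mat_vec[OF _ MT u(1)]) (use A_carrier in simp)
    with left_step[of "(M n)\<^sup>T *\<^sub>v u" n B] Suc \<open>B > 0\<close> show ?case by simp
  qed
  from this[of N] i0(1) have "padic_norm ((\<nu> \<cdot>\<^sub>v u) $ i0) \<le> B" unfolding u(3) by blast
  then have "padic_norm \<nu> * B \<le> 1 * B" using i0 u(1) by (simp add: padic_norm_mult)
  with \<open>B > 0\<close> show ?thesis by (simp only: mult_le_cancel_right_pos)
qed

lemma greatest_root: "is_greatest_root (mcf_char_poly m \<alpha> N) \<mu>"
proof -
  have "w 0 $ m = 1" by (simp add: w_def v_def)
  then have "w 0 \<noteq> 0\<^sub>v (m + 1)" by auto
  then have "eigenvalue (M N) \<mu>"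
    using M_w_mu w_carrier[of 0] carrier_matD(1)[OF M_carrier[of N]]
    unfolding eigenvalue_def eigenvector_def by metis
  then show ?thesis
    unfolding is_greatest_root_def poly_root_iff
    using other_roots norm_mu by (auto intro: le_less_trans)
qed

end

text \<open>The product of the first complete quotients over one period is indeed the root of largest norm.\<close>

theorem mcf_greatest_root:
  fixes \<alpha> :: "nat \<Rightarrow> 'p::prime_card padic"
  assumes "odd CARD('p)" "m \<ge> 1" "N \<ge> 1" "purely_periodic_mcf m \<alpha> N"
  shows "is_greatest_root (mcf_char_poly m \<alpha> N) (\<Prod>n<N. jp_complete m \<alpha> n 1)"
proof -
  interpret periodic_mcf \<alpha> m N by standard (use assms in auto)
  show ?thesis using greatest_root by (simp add: \<mu>_def)
qed

section \<open>Generated subfields\<close>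

definition is_subfield :: "'a::field set \<Rightarrow> bool" where
  "is_subfield K \<longleftrightarrow> 0 \<in> K \<and> 1 \<in> K \<and> (\<forall>x\<in>K. \<forall>y\<in>K. x + y \<in> K \<and> x * y \<in> K) \<and>
     (\<forall>x\<in>K. - x \<in> K \<and> inverse x \<in> K)"

text \<open>In characteristic \<open>0\<close> every subfield contains \<open>\<rat>\<close>, so the smallest subfield
  containing \<open>S\<close> is \<open>\<rat>(S)\<close>.\<close>

definition rat_adjoin :: "'a::field_char_0 set \<Rightarrow> 'a set" where
  "rat_adjoin S = is_subfield hull S"

end

theory Submission
  imports Defs
begin

text \<open>
  Write \<open>K = \<rat>(\<mu>)\<close> and let \<open>w = (\<alpha>\<^sup>1, \<dots>, \<alpha>\<^sup>m, 1)\<close> be the input in homogeneous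
  coordinates. One period of the algorithm says that \<open>w\<close> is an eigenvector of the rational matrix
  \<open>M\<close> of the period, with eigenvalue \<open>\<mu>\<close>.

  \<^emph>\<open>Equality of the fields.\<close> All complete quotients are rational expressions in the input, so their
  product \<open>\<mu>\<close> lies in the field that the input generates. For the converse, the transpose of \<open>M\<close>
  does not increase norms on the hyperplane orthogonal to \<open>w\<close>, whereas \<open>\<mu>\<close> has norm larger than
  \<open>1\<close>; hence this hyperplane annihilates the whole eigenspace of \<open>\<mu>\<close>, which is therefore the line
  spanned by \<open>w\<close> (\<open>eigenvector_unique\<close>). As \<open>M\<close> and \<open>\<mu>\<close> are defined over \<open>K\<close>, a
  \<open>K\<close>-linear projection \<open>f\<close> from a space containing the entries of \<open>w\<close> onto \<open>K\<close>
  (\<open>projection_onto_subfield\<close>), applied entrywise, turns \<open>w\<close> into an eigenvector with the same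
  eigenvalue and the same last entry \<open>1\<close>. The two agree, so the entries of \<open>w\<close> lie in \<open>K\<close>.

  \<^emph>\<open>Irrationality.\<close> If \<open>\<mu>\<close> were rational, the input would be rational by the first part. But on
  rational input the algorithm stops (\<open>rational_input_stops\<close>). Otherwise the inverse steps, applied
  to \<open>w\<close> without renormalising, would give an infinite sequence of rational vectors with nonzero last
  entries \<open>z n\<close>. These have \<open>p\<close>-adic absolute value at most \<open>p\<close> to the power \<open>- n\<close> and bounded
  denominators apart from powers of \<open>p\<close>. Browkin's function is bounded by \<open>p/2\<close> in the real
  absolute value, so \<open>z n\<close> grows at most like the \<open>n\<close>-th power of \<open>1 + p/2\<close>, and \<open>1 + p/2 < p\<close>
  for \<open>p\<close> odd. The product of both absolute values of \<open>z n\<close> thus tends to \<open>0\<close>, against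
  the product formula (\<open>product_formula_bound\<close>).
\<close>

section \<open>Subfields and projections onto them\<close>

lemma is_subfield_Rats: "is_subfield (\<rat> :: 'a::field_char_0 set)"
  by (auto simp: is_subfield_def)

lemma is_subfield_rat_adjoin: "is_subfield (rat_adjoin S)"
  unfolding rat_adjoin_def by (rule hull_in) (auto simp: is_subfield_def)

lemma subset_rat_adjoin: "S \<subseteq> rat_adjoin S"
  unfolding rat_adjoin_def by (rule hull_subset)

lemma rat_adjoin_minimal: "S \<subseteq> K \<Longrightarrow> is_subfield K \<Longrightarrow> rat_adjoin S \<subseteq> K"
  unfolding rat_adjoin_def by (rule hull_minimal)

context
  fixes K :: "'a::field_char_0 set"
  assumes K: "is_subfield K"
begin

lemma subfield_0: "0 \<in> K" and subfield_1: "1 \<in> K"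
  and subfield_add: "x \<in> K \<Longrightarrow> y \<in> K \<Longrightarrow> x + y \<in> K"
  and subfield_mult: "x \<in> K \<Longrightarrow> y \<in> K \<Longrightarrow> x * y \<in> K"
  and subfield_minus: "x \<in> K \<Longrightarrow> - x \<in> K"
  and subfield_inverse: "x \<in> K \<Longrightarrow> inverse x \<in> K"
  using K by (auto simp: is_subfield_def)

lemma subfield_diff: "x \<in> K \<Longrightarrow> y \<in> K \<Longrightarrow> x - y \<in> K"
  using subfield_add[of x "- y"] subfield_minus by simp

lemma subfield_divide: "x \<in> K \<Longrightarrow> y \<in> K \<Longrightarrow> x / y \<in> K"
  unfolding divide_inverse by (intro subfield_mult subfield_inverse)

lemma subfield_prod: "(\<And>i. i \<in> I \<Longrightarrow> f i \<in> K) \<Longrightarrow> prod f I \<in> K"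
  by (induction I rule: infinite_finite_induct) (auto intro: subfield_1 subfield_mult)

lemma subfield_of_rat: "of_rat q \<in> K"
proof -
  have nat: "of_nat n \<in> K" for n
    by (induction n) (auto intro: subfield_0 subfield_1 subfield_add)
  have int: "of_int k \<in> K" for k
    by (cases k rule: int_cases2) (auto intro: nat subfield_minus)
  obtain a b where "q = Rat.Fract a b" "b > 0" by (cases q)
  then show ?thesis by (auto simp: of_rat_rat intro: subfield_divide int)
qed

end

definition is_subspace :: "'a::field set \<Rightarrow> 'a set \<Rightarrow> bool" where
  "is_subspace K V \<longleftrightarrow> 0 \<in> V \<and> (\<forall>x\<in>V. \<forall>y\<in>V. x + y \<in> V) \<and> (\<forall>k\<in>K. \<forall>x\<in>V. k * x \<in> V)"

definition linear_into :: "'a::field set \<Rightarrow> 'a set \<Rightarrow> ('a \<Rightarrow> 'a) \<Rightarrow> bool" where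
  "linear_into K V f \<longleftrightarrow> (\<forall>x\<in>V. f x \<in> K) \<and> (\<forall>x\<in>V. \<forall>y\<in>V. f (x + y) = f x + f y) \<and>
     (\<forall>k\<in>K. \<forall>x\<in>V. f (k * x) = k * f x)"

text \<open>Membership of the sum in \<open>V\<close> is part of the claim because the induction needs it in order to
  apply additivity, which holds on \<open>V\<close> only.\<close>

lemma linear_into_sum:
  assumes "is_subspace K V" "linear_into K V f" "\<And>i. i \<in> I \<Longrightarrow> c i \<in> K" "\<And>i. i \<in> I \<Longrightarrow> x i \<in> V"
    "finite I"
  shows "(\<Sum>i\<in>I. c i * x i) \<in> V \<and> f (\<Sum>i\<in>I. c i * x i) = (\<Sum>i\<in>I. c i * f (x i))"
  using assms(5,3,4)
proof (induction I rule: finite_induct)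
  case empty
  have "f (0 + 0) = f 0 + f 0" using assms(1,2) unfolding is_subspace_def linear_into_def by blast
  then have "f 0 = 0" by (simp only: add_0_right add_cancel_right_right)
  then show ?case using assms(1) by (simp add: is_subspace_def)
next
  case (insert i I)
  then have "c i \<in> K" "x i \<in> V" by auto
  with insert assms(1,2) show ?case by (auto simp: is_subspace_def linear_into_def)
qed

text \<open>The identity of \<open>K\<close> is extended by sending each further element of \<open>F\<close> that is independent of
  the previous ones to \<open>0\<close>.\<close>

lemma projection_onto_subfield:
  fixes K :: "'a::field_char_0 set"
  assumes K: "is_subfield K" and "finite F"
  obtains V f where "F \<subseteq> V" "is_subspace K V" "linear_into K V f" "f 1 = 1"
proof -
  have "\<exists>V f. F \<subseteq> V \<and> 1 \<in> V \<and> is_subspace K V \<and> linear_into K V f \<and> f 1 = 1"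
    using assms(2)
  proof (induction F rule: finite_induct)
    case empty
    show ?case
      by (rule exI[of _ K], rule exI[of _ id])
        (use K in \<open>auto simp: is_subspace_def linear_into_def is_subfield_def\<close>)
  next
    case (insert x F)
    then obtain V f where V: "F \<subseteq> V" "1 \<in> V" and sub: "is_subspace K V" and lin: "linear_into K V f"
      and f1: "f 1 = 1" by blast
    show ?case
    proof (cases "x \<in> V")
      case True
      then show ?thesis using V sub lin f1 by blast
    next
      case False
      have unique: "v = v' \<and> k = k'" if "v + k * x = v' + k' * x" "v \<in> V" "v' \<in> V" "k \<in> K" "k' \<in> K" for v v' k k'
      proof -
        have "k = k'"
        proof (rule ccontr)
          assume "k \<noteq> k'"
          then have "x = inverse (k - k') * (v' + (- 1) * v)"
            using that(1) by (simp add: field_simps)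
          moreover have "inverse (k - k') \<in> K" "- 1 \<in> K"
            using that K by (auto intro: subfield_inverse subfield_diff subfield_minus subfield_1)
          ultimately have "x \<in> V" using sub that unfolding is_subspace_def by metis
          with False show False ..
        qed
        then show ?thesis using that(1) by simp
      qed
      \<comment> \<open>the decomposition is unique, so \<open>f\<close> extends to the larger space by \<open>x \<mapsto> 0\<close>\<close>
      define W where "W = {v + k * x | v k. v \<in> V \<and> k \<in> K}"
      define g where "g y = f (THE v. v \<in> V \<and> (\<exists>k\<in>K. y = v + k * x))" for y
      have g: "g (v + k * x) = f v" if "v \<in> V" "k \<in> K" for v k
        unfolding g_def by (rule arg_cong[of _ _ f], rule the_equality) (use that unique in blast)+
      have WI: "v + k * x \<in> W" if "v \<in> V" "k \<in> K" for v k using that by (auto simp: W_def)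
      have g0: "g v = f v" "v \<in> W" if "v \<in> V" for v
        using g[OF that subfield_0[OF K]] WI[OF that subfield_0[OF K]] by auto
      have add: "(v + k * x) + (v' + k' * x) = (v + v') + (k + k') * x"
        and mult: "c * (v + k * x) = c * v + (c * k) * x" for v v' k k' c :: 'a
        by (simp_all add: algebra_simps)
      have subV: "v + v' \<in> V" "k \<in> K \<Longrightarrow> k * v \<in> V" if "v \<in> V" "v' \<in> V" for v v' k
        using sub that by (auto simp: is_subspace_def)
      have "0 \<in> W" using sub g0 by (simp add: is_subspace_def)
      moreover have "y + z \<in> W \<and> g (y + z) = g y + g z" if yz: "y \<in> W" "z \<in> W" for y z
      proof -
        obtain v k where y: "y = v + k * x" "v \<in> V" "k \<in> K" using yz unfolding W_def by blast
        obtain v' k' where z: "z = v' + k' * x" "v' \<in> V" "k' \<in> K" using yz unfolding W_def by blast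
        have "k + k' \<in> K" "v + v' \<in> V" using y z subV subfield_add[OF K] by auto
        moreover have "f (v + v') = f v + f v'" using lin y z by (simp add: linear_into_def)
        ultimately show ?thesis unfolding y(1) z(1) add using g WI y z by metis
      qed
      moreover have "c * y \<in> W \<and> g (c * y) = c * g y \<and> g y \<in> K" if cy: "c \<in> K" "y \<in> W" for c y
      proof -
        obtain v k where y: "y = v + k * x" "v \<in> V" "k \<in> K" using cy unfolding W_def by blast
        have "c * k \<in> K" "c * v \<in> V" using y cy subV subfield_mult[OF K] by auto
        moreover have "f (c * v) = c * f v" "f v \<in> K" using lin y cy by (auto simp: linear_into_def)
        ultimately show ?thesis unfolding y(1) mult using g WI y by metis
      qed
      ultimately have "is_subspace K W" "linear_into K W g"
        using subfield_1[OF K] unfolding is_subspace_def linear_into_def by blast+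
      moreover have "x \<in> W"
        using WI[of 0 1] sub subfield_1[OF K] by (simp add: is_subspace_def)
      ultimately show ?thesis
        using V g0 f1 by (intro exI[of _ W] exI[of _ g]) auto
    qed
  qed
  then show ?thesis using that by blast
qed

section \<open>The eigenspace of the period matrix\<close>

context periodic_mcf
begin

text \<open>A single step does not increase norms on the hyperplane orthogonal to the current vector of
  complete quotients and maps it to the hyperplane of the next step; these facts compose.\<close>

lemma transpose_M_bound:
  assumes "u \<in> carrier_vec (m + 1)" "u \<bullet> w 0 = 0" "\<And>i. i < m + 1 \<Longrightarrow> padic_norm (u $ i) \<le> B" "B \<ge> 0"
  shows "(M n)\<^sup>T *\<^sub>v u \<in> carrier_vec (m + 1) \<and> ((M n)\<^sup>T *\<^sub>v u) \<bullet> w n = 0 \<and>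
    (\<forall>i<m + 1. padic_norm (((M n)\<^sup>T *\<^sub>v u) $ i) \<le> B)"
proof (induction n)
  case 0
  then show ?case using assms by (simp add: M_0)
next
  case (Suc n)
  have "(M (Suc n))\<^sup>T *\<^sub>v u = (A n)\<^sup>T *\<^sub>v ((M n)\<^sup>T *\<^sub>v u)"
    unfolding M_Suc transpose_mult[OF M_carrier A_carrier]
    by (rule assoc_mult_mat_vec[OF transpose_carrier_mat[THEN iffD2, OF A_carrier]
        transpose_carrier_mat[THEN iffD2, OF M_carrier] assms(1)])
  with left_step[of "(M n)\<^sup>T *\<^sub>v u" n B] Suc assms(4) show ?case by simp
qed

text \<open>Replacing \<open>u\<close> by its image under the transpose multiplies \<open>u \<bullet> x\<close> by \<open>\<mu>\<close>, but keeps the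
  bound on the entries of \<open>u\<close>. Since \<open>\<mu>\<close> has norm larger than \<open>1\<close>, iterating would make
  \<open>u \<bullet> x\<close> unbounded unless it vanishes.\<close>

lemma orthogonal_to_eigenvectors:
  assumes x: "x \<in> carrier_vec (m + 1)" "M N *\<^sub>v x = \<mu> \<cdot>\<^sub>v x"
    and u: "u \<in> carrier_vec (m + 1)" "u \<bullet> w 0 = 0"
  shows "u \<bullet> x = 0"
proof (rule ccontr)
  assume ne: "u \<bullet> x \<noteq> 0"
  have bounded: "\<exists>B\<ge>0. \<forall>i<m + 1. padic_norm (y $ i) \<le> B" for y :: "'p padic vec"
    by (rule exI[of _ "\<Sum>i<m + 1. padic_norm (y $ i)"])
      (auto intro!: member_le_sum sum_nonneg simp del: sum.lessThan_Suc)
  obtain B where B: "B \<ge> 0" "\<And>i. i < m + 1 \<Longrightarrow> padic_norm (u $ i) \<le> B" using bounded by blast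
  obtain C where C: "C \<ge> 0" "\<And>i. i < m + 1 \<Longrightarrow> padic_norm (x $ i) \<le> C" using bounded by blast
  have "padic_norm \<mu> ^ k * padic_norm (u \<bullet> x) \<le> B * C" for k
    using u B(2)
  proof (induction k arbitrary: u)
    case 0
    have "padic_norm (\<Sum>i\<in>{0..<m + 1}. u $ i * x $ i) \<le> B * C"
      using 0 B(1) C by (intro padic_norm_sum_le) (auto simp: padic_norm_mult intro!: mult_mono)
    then show ?case using x by (simp add: scalar_prod_def)
  next
    case (Suc k)
    have "((M N)\<^sup>T *\<^sub>v u) \<bullet> x = u \<bullet> (M N *\<^sub>v x)"
      by (rule transpose_vec_mult_scalar[OF M_carrier x(1) Suc.prems(1)])
    also have "\<dots> = \<mu> * (u \<bullet> x)" unfolding x(2) using Suc.prems(1) x(1) by simp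
    finally show ?case
      using Suc.IH[of "(M N)\<^sup>T *\<^sub>v u"] transpose_M_bound[OF Suc.prems(1,2,3) B(1), of N] w_periodic[of 0]
      by (simp add: padic_norm_mult ac_simps)
  qed
  moreover obtain k where k: "B * C / padic_norm (u \<bullet> x) < padic_norm \<mu> ^ k"
    using real_arch_pow[OF norm_mu] by blast
  ultimately have "padic_norm \<mu> ^ k \<le> B * C / padic_norm (u \<bullet> x)"
    using ne by (simp add: pos_le_divide_eq)
  with k show False by simp
qed

text \<open>The hyperplane orthogonal to \<open>w 0\<close> contains enough vectors to compare \<open>x\<close> with \<open>w 0\<close>
  entry by entry, since the last entry of \<open>w 0\<close> is \<open>1\<close>.\<close>

lemma eigenvector_unique:
  assumes x: "x \<in> carrier_vec (m + 1)" "M N *\<^sub>v x = \<mu> \<cdot>\<^sub>v x"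
  shows "x = x $ m \<cdot>\<^sub>v w 0"
proof (rule eq_vecI)
  fix i assume "i < dim_vec (x $ m \<cdot>\<^sub>v w 0)"
  then have i: "i < m + 1" by (simp add: w_def)
  have wm: "w 0 $ m = 1" by (simp add: w_def v_def)
  \<comment> \<open>orthogonal to \<open>w 0\<close>; its product with \<open>x\<close> is the minor of \<open>x\<close> and \<open>w 0\<close> at \<open>i\<close> and \<open>m\<close>\<close>
  define u where "u = unit_vec (m + 1) i - w 0 $ i \<cdot>\<^sub>v unit_vec (m + 1) m"
  have u: "u \<in> carrier_vec (m + 1)" by (simp add: u_def)
  have dot: "u \<bullet> y = y $ i - w 0 $ i * y $ m" if "y \<in> carrier_vec (m + 1)" for y
    unfolding u_def using that i
    by (subst minus_scalar_prod_distrib[of _ "m + 1"]) auto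
  have "u \<bullet> x = 0"
    by (rule orthogonal_to_eigenvectors[OF x u]) (simp add: dot[OF w_carrier] wm)
  then show "x $ i = (x $ m \<cdot>\<^sub>v w 0) $ i" using i by (simp add: dot[OF x(1)] w_def)
qed (use x in \<open>auto simp: w_def\<close>)

text \<open>Descent: a line of eigenvectors of a matrix over \<open>K\<close>, with eigenvalue in \<open>K\<close>, is fixed by
  \<open>K\<close>-linear projections, so its normalised generator has entries in \<open>K\<close>.\<close>

lemma input_in_rat_adjoin_mu:
  assumes "i \<in> {1..m}"
  shows "\<alpha> i \<in> rat_adjoin {\<mu>}"
proof -
  let ?K = "rat_adjoin {\<mu>}"
  note K = is_subfield_rat_adjoin[of "{\<mu>}"]
  obtain V f where V: "(\<lambda>i. w 0 $ i) ` {..<m + 1} \<subseteq> V" "is_subspace ?K V" "linear_into ?K V f" "f 1 = 1"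
    by (rule projection_onto_subfield[OF K, of "(\<lambda>i. w 0 $ i) ` {..<m + 1}"]) auto
  have wV: "w 0 $ i \<in> V" if "i < m + 1" for i using V(1) that by blast
  define y where "y = vec (m + 1) (\<lambda>i. f (w 0 $ i))"
  have "M N *\<^sub>v y = \<mu> \<cdot>\<^sub>v y"
  proof (rule eq_vecI)
    fix i assume "i < dim_vec (\<mu> \<cdot>\<^sub>v y)"
    then have i: "i < m + 1" by (simp add: y_def)
    have entry: "M N $$ (i, j) \<in> ?K" if "j < m + 1" for j
      using i that prod_carrier[of N] by (auto simp: M_def intro: subfield_of_rat[OF K])
    have row: "(M N *\<^sub>v z) $ i = (\<Sum>j\<in>{0..<m + 1}. M N $$ (i, j) * z $ j)" if "z \<in> carrier_vec (m + 1)" for z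
      using i that carrier_matD[OF M_carrier[of N]] by (auto simp: scalar_prod_def intro!: sum.cong)
    have "(M N *\<^sub>v y) $ i = (\<Sum>j\<in>{0..<m + 1}. M N $$ (i, j) * f (w 0 $ j))"
      by (subst row) (auto simp: y_def intro!: sum.cong)
    also have "\<dots> = f (\<Sum>j\<in>{0..<m + 1}. M N $$ (i, j) * w 0 $ j)"
      using linear_into_sum[OF V(2,3), of "{0..<m + 1}" "\<lambda>j. M N $$ (i, j)" "\<lambda>j. w 0 $ j"] entry wV by simp
    also have "(\<Sum>j\<in>{0..<m + 1}. M N $$ (i, j) * w 0 $ j) = \<mu> * w 0 $ i"
      using row[OF w_carrier, of 0, symmetric] i unfolding M_w_mu by (simp only:) (simp add: w_def)
    also have "f (\<mu> * w 0 $ i) = \<mu> * f (w 0 $ i)"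
      using V(3) wV[OF i] subset_rat_adjoin[of "{\<mu>}"] by (auto simp: linear_into_def)
    finally show "(M N *\<^sub>v y) $ i = (\<mu> \<cdot>\<^sub>v y) $ i" using i by (simp add: y_def)
  qed (use M_carrier[of N] in \<open>auto simp: y_def\<close>)
  moreover have "y \<in> carrier_vec (m + 1)" by (simp add: y_def)
  moreover have "y $ m = 1" by (simp add: y_def w_def v_def V(4))
  ultimately have "y = w 0" using eigenvector_unique[of y] by simp
  then have "\<alpha> i = y $ (i - 1)" using assms by (auto simp: w_def v_def)
  moreover have "y $ (i - 1) \<in> ?K"
    using V(3) wV[of "i - 1"] assms by (auto simp: y_def linear_into_def)
  ultimately show ?thesis by simp
qed

end

lemma complete_quotient_in_subfield:
  assumes K: "is_subfield K" and \<alpha>: "\<And>i. i \<in> {1..m} \<Longrightarrow> \<alpha> i \<in> K" and "i \<in> {1..m}"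
  shows "jp_complete m \<alpha> n i \<in> K"
  using assms(3)
proof (induction n arbitrary: i)
  case (Suc n)
  have "jp_complete m \<alpha> n j - of_rat (browkin_s (jp_complete m \<alpha> n j)) \<in> K" if "j \<in> {1..m}" for j
    using Suc.IH[OF that] by (intro subfield_diff[OF K] subfield_of_rat[OF K])
  moreover have "m \<in> {1..m}" "i \<noteq> 1 \<Longrightarrow> i - 1 \<in> {1..m}" using Suc.prems by auto
  ultimately show ?case
    by (auto simp: Let_def intro!: subfield_divide[OF K] subfield_1[OF K])
qed (use \<alpha> in simp)

section \<open>Rational inputs stop the algorithm\<close>

text \<open>These are the elements of the ring \<open>\<int>[1/p]\<close>.\<close>

definition p_integral :: "nat \<Rightarrow> rat \<Rightarrow> bool" where
  "p_integral p q \<longleftrightarrow> (\<exists>k. of_nat p ^ k * q \<in> \<int>)"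

lemma p_integral_of_int: "q \<in> \<int> \<Longrightarrow> p_integral p q"
  unfolding p_integral_def by (rule exI[of _ 0]) simp

lemma p_integral_add:
  assumes "p_integral p q" "p_integral p r"
  shows "p_integral p (q + r)"
proof -
  obtain k l where "of_nat p ^ k * q \<in> \<int>" "of_nat p ^ l * r \<in> \<int>"
    using assms by (auto simp: p_integral_def)
  then have "of_nat p ^ l * (of_nat p ^ k * q) + of_nat p ^ k * (of_nat p ^ l * r) \<in> \<int>"
    by (meson Ints_add Ints_mult Ints_power Ints_of_nat)
  then show ?thesis unfolding p_integral_def
    by (intro exI[of _ "k + l"]) (simp add: power_add algebra_simps)
qed

lemma p_integral_mult:
  assumes "p_integral p q" "p_integral p r"
  shows "p_integral p (q * r)"
proof -
  obtain k l where "of_nat p ^ k * q \<in> \<int>" "of_nat p ^ l * r \<in> \<int>"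
    using assms by (auto simp: p_integral_def)
  then have "(of_nat p ^ k * q) * (of_nat p ^ l * r) \<in> \<int>" by (rule Ints_mult)
  then show ?thesis unfolding p_integral_def
    by (intro exI[of _ "k + l"]) (simp add: power_add algebra_simps)
qed

lemma p_integral_sum: "(\<And>i. i \<in> I \<Longrightarrow> p_integral p (f i)) \<Longrightarrow> p_integral p (sum f I)"
  by (induction I rule: infinite_finite_induct) (auto intro: p_integral_add p_integral_of_int)

lemma p_integral_powi: "p > 0 \<Longrightarrow> p_integral p (of_nat p powi j)"
proof (cases "j \<ge> 0")
  case True
  then show ?thesis by (auto simp: power_int_def intro: p_integral_of_int)
next
  case False
  assume "p > 0"
  with False show ?thesis unfolding p_integral_def
    by (intro exI[of _ "nat (- j)"]) (auto simp: power_int_def power_inverse)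
qed

text \<open>Multiplying \<open>q\<close> by its \<open>p\<close>-adic absolute value removes all powers of \<open>p\<close>. What remains of an
  element of \<open>\<int>[1/p]\<close> is, up to sign, a nonzero integer.\<close>

lemma product_formula_bound:
  assumes p: "prime p" and "p_integral p q" "q \<noteq> 0"
  shows "1 \<le> of_rat \<bar>q\<bar> * padic_abs p q"
proof -
  obtain k a where a: "of_nat p ^ k * q = of_int a"
    using assms(2) by (auto simp: p_integral_def elim: Ints_cases)
  have p0: "p > 0" using p by (rule prime_gt_0_nat)
  have q: "q = of_int a / of_int (int p ^ k)" using a p0 by (simp add: field_simps)
  have a0: "a \<noteq> 0" using assms(3) q by auto
  let ?e = "multiplicity (int p) a"
  have "int p ^ ?e \<le> \<bar>a\<bar>" using a0 by (intro zdvd_imp_le) (auto simp: multiplicity_dvd)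
  then have "real_of_int (int p ^ ?e) \<le> real_of_int \<bar>a\<bar>" by (simp only: of_int_le_iff)
  then have le: "real p ^ ?e \<le> \<bar>real_of_int a\<bar>" by simp
  have "multiplicity (int p) (int p ^ k) = k"
    using p by (intro multiplicity_same_power) auto
  then have "padic_abs p q = real p powi (int k - int ?e)"
    using padic_abs_divide[OF p a0, of "int p ^ k"] p0 unfolding q by simp
  then have "padic_abs p q = real p ^ k / real p ^ ?e" using p0 by (simp add: power_int_diff)
  moreover have "of_rat \<bar>q\<bar> = \<bar>real_of_int a\<bar> / real p ^ k"
  proof -
    have "\<bar>q\<bar> = of_int \<bar>a\<bar> / of_nat p ^ k" unfolding q by (simp add: abs_divide)
    then show ?thesis
      by (simp only: of_rat_divide of_rat_power of_rat_of_int_eq of_rat_of_nat_eq)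
  qed
  ultimately have "of_rat \<bar>q\<bar> * padic_abs p q = \<bar>real_of_int a\<bar> / real p ^ ?e"
    using p0 by simp
  then show ?thesis using le p0 by simp
qed

lemma common_denominator:
  fixes q :: "'b \<Rightarrow> rat"
  assumes "finite I"
  obtains D :: nat where "D > 0" "\<And>i. i \<in> I \<Longrightarrow> of_nat D * q i \<in> \<int>"
proof -
  have "\<exists>D::nat. D > 0 \<and> (\<forall>i\<in>I. of_nat D * q i \<in> \<int>)"
    using assms
  proof (induction I rule: finite_induct)
    case empty
    show ?case by (rule exI[of _ 1]) simp
  next
    case (insert i I)
    then obtain D :: nat where D: "D > 0" "\<forall>i\<in>I. of_nat D * q i \<in> \<int>" by blast
    obtain a b where ab: "quotient_of (q i) = (a, b)" by (cases "quotient_of (q i)")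
    have b: "b > 0" "q i = of_int a / of_int b"
      using quotient_of_denom_pos[OF ab] quotient_of_div[OF ab] by auto
    have nb: "of_nat (nat b) = (of_int b :: rat)" using b by simp
    have "of_nat (D * nat b) * q j \<in> \<int>" if "j \<in> insert i I" for j
    proof (cases "j = i")
      case True
      then show ?thesis using b by (simp add: nb)
    next
      case False
      with that D have "of_nat D * q j \<in> \<int>" by blast
      then have "of_int b * (of_nat D * q j) \<in> \<int>" by (rule Ints_mult[OF Ints_of_int])
      then show ?thesis by (simp add: nb ac_simps)
    qed
    then show ?case using D b by (intro exI[of _ "D * nat b"]) auto
  qed
  then show ?thesis using that by blast
qed

lemma browkin_s_p_integral: "p_integral CARD('p) (browkin_s (x :: 'p::prime_card padic))"
  unfolding browkin_s_def Let_def
  by (intro p_integral_sum p_integral_mult p_integral_powi p_integral_of_int) auto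

text \<open>The digits are at most \<open>(p - 1) / 2\<close> in absolute value, and the powers of \<open>p\<close> with nonpositive
  exponents sum to \<open>p / (p - 1)\<close>.\<close>

lemma browkin_s_bound:
  fixes x :: "'p::prime_card padic"
  assumes odd: "odd CARD('p)"
  shows "\<bar>browkin_s x\<bar> \<le> of_nat CARD('p) / 2"
proof -
  define p where "p = (of_nat CARD('p) :: rat)"
  have p1: "p > 1" using prime_gt_1_nat[OF prime_card[where ?'a='p]] by (simp add: p_def)
  define d where "d = (THE d. browkin_expansion x d)"
  have d: "browkin_expansion x d"
    unfolding d_def by (rule theI'[OF browkin_expansion_ex1[OF odd]])
  have digit: "\<bar>of_int (d j)\<bar> \<le> (p - 1) / 2" for j
  proof -
    have "2 * \<bar>d j\<bar> \<le> int CARD('p) - 1" using d by (simp add: browkin_expansion_def)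
    then have "(of_int (2 * \<bar>d j\<bar>) :: rat) \<le> of_int (int CARD('p) - 1)" by (simp only: of_int_le_iff)
    then show ?thesis by (simp add: p_def)
  qed
  obtain k where k: "\<And>j. j < k \<Longrightarrow> d j = 0" using d by (auto simp: browkin_expansion_def)
  define n where "n = nat (- k)"
  have geom: "(p - 1) / 2 * (\<Sum>i\<le>n. inverse p ^ i) \<le> p / 2" for n
  proof -
    have "(p - 1) / 2 * (\<Sum>i\<le>n. inverse p ^ i) = p / 2 - inverse p ^ n / 2"
    proof (induction n)
      case 0
      then show ?case by (simp add: field_simps)
    next
      case (Suc n)
      have "(p - 1) / 2 * (\<Sum>i\<le>Suc n. inverse p ^ i)
          = p / 2 - inverse p ^ n / 2 + (p - 1) / 2 * inverse p ^ Suc n"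
        using Suc by (simp add: distrib_left)
      also have "\<dots> = p / 2 - inverse p ^ Suc n / 2" using p1 by (simp add: field_simps)
      finally show ?case .
    qed
    then show ?thesis using p1 by simp
  qed
  have "{j. j \<le> 0 \<and> d j \<noteq> 0} \<subseteq> (\<lambda>i. - int i) ` {..n}"
  proof
    fix j assume "j \<in> {j. j \<le> 0 \<and> d j \<noteq> 0}"
    then have "j = - int (nat (- j))" "nat (- j) \<le> n" using k[of j] by (auto simp: n_def not_less[symmetric])
    then show "j \<in> (\<lambda>i. - int i) ` {..n}" by blast
  qed
  then have "browkin_s x = (\<Sum>j\<in>(\<lambda>i. - int i) ` {..n}. of_int (d j) * p powi j)"
    unfolding browkin_s_def d_def[symmetric] Let_def p_def
    by (intro sum.mono_neutral_left) auto
  also have "\<dots> = (\<Sum>i\<le>n. of_int (d (- int i)) * inverse p ^ i)"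
    by (subst sum.reindex) (auto simp: inj_on_def power_int_minus power_inverse)
  also have "\<bar>\<dots>\<bar> \<le> (\<Sum>i\<le>n. (p - 1) / 2 * inverse p ^ i)"
    by (rule order.trans[OF sum_abs], rule sum_mono)
      (use digit p1 in \<open>auto simp: abs_mult intro!: mult_right_mono\<close>)
  also have "\<dots> \<le> p / 2" using geom[of n] by (simp add: sum_distrib_left)
  finally show ?thesis by (simp add: p_def)
qed

text \<open>The vectors \<open>z n\<close> times \<open>(\<beta> n 1, \<dots>, \<beta> n m, 1)\<close> evolve without division: each step moves the
  last entry to the front and shifts the others after subtracting partial quotients times the last
  entry. This keeps the denominators in \<open>D\<close> times powers of \<open>p\<close> and multiplies the largest real
  absolute value by at most \<open>1 + p/2\<close>, while every factor of \<open>z n\<close> has \<open>p\<close>-adic norm at most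
  \<open>1/p\<close>.\<close>

theorem rational_input_stops:
  fixes \<alpha> :: "nat \<Rightarrow> 'p::prime_card padic"
  assumes odd: "odd CARD('p)" and m: "m \<ge> 1" and rational: "\<And>i. i \<in> {1..m} \<Longrightarrow> \<alpha> i \<in> \<rat>"
  shows "\<not> jp_never_stops m \<alpha>"
proof
  assume "jp_never_stops m \<alpha>"
  define \<beta> where "\<beta> n i = (if i \<le> m then jp_complete m \<alpha> n i else 1)" for n i
  define a where "a n i = jp_partial m \<alpha> n i" for n i
  have nonstop: "\<beta> n m \<noteq> of_rat (a n m)" for n
    using \<open>jp_never_stops m \<alpha>\<close> by (simp add: jp_never_stops_def \<beta>_def a_def)
  \<comment> \<open>the scaling factor that clears the divisions of the first \<open>n\<close> steps\<close>
  define z where "z n = (\<Prod>k<n. \<beta> k m - of_rat (a k m))" for n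
  have z0: "z n \<noteq> 0" for n using nonstop by (simp add: z_def)
  define P where "P = (of_nat CARD('p) :: rat)"
  have "CARD('p) \<ge> 2" by (rule prime_ge_2_nat[OF prime_card])
  moreover have "CARD('p) \<noteq> 2" using odd by (metis even_numeral)
  ultimately have "CARD('p) \<ge> 3" by linarith
  then have P: "P \<ge> 3" unfolding P_def by simp
  have step: "\<beta> (Suc n) 1 * z (Suc n) = z n"
    "i \<in> {1..m} \<Longrightarrow> \<beta> (Suc n) (Suc i) * z (Suc n) = \<beta> n i * z n - of_rat (a n i) * z n" for n i
  proof -
    have zS: "z (Suc n) = (\<beta> n m - of_rat (a n m)) * z n" by (simp add: z_def)
    have ne: "\<beta> n m - of_rat (a n m) \<noteq> 0" using nonstop[of n] by simp
    have "\<beta> (Suc n) 1 = 1 / (\<beta> n m - of_rat (a n m))"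
      using m by (simp add: \<beta>_def a_def Let_def jp_partial_def)
    then show "\<beta> (Suc n) 1 * z (Suc n) = z n" using ne by (simp add: zS)
    show "\<beta> (Suc n) (Suc i) * z (Suc n) = \<beta> n i * z n - of_rat (a n i) * z n" if "i \<in> {1..m}"
    proof (cases "i = m")
      case True
      then show ?thesis unfolding zS by (simp add: \<beta>_def algebra_simps)
    next
      case False
      with that have "\<beta> (Suc n) (Suc i) = (\<beta> n i - of_rat (a n i)) / (\<beta> n m - of_rat (a n m))"
        by (auto simp: \<beta>_def a_def Let_def jp_partial_def)
      then have "\<beta> (Suc n) (Suc i) * z (Suc n) = (\<beta> n i - of_rat (a n i)) * z n"
        using ne unfolding zS by simp
      then show ?thesis by (simp add: left_diff_distrib)
    qed
  qed
  obtain q where q: "\<And>i. i \<in> {1..m} \<Longrightarrow> \<alpha> i = of_rat (q i)"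
    using rational unfolding Rats_def image_iff by metis
  obtain D where D: "D > 0" "\<And>i. i \<in> {1..m} \<Longrightarrow> of_nat D * q i \<in> \<int>"
    by (rule common_denominator[of "{1..m}" q]) auto
  define C where "C = 1 + (\<Sum>i\<in>{1..m}. \<bar>q i\<bar>)"
  have qC: "\<bar>q i\<bar> \<le> C" if "i \<in> {1..m}" for i
    using member_le_sum[of i "{1..m}" "\<lambda>i. \<bar>q i\<bar>"] that by (simp add: C_def)
  have C1: "C \<ge> 1" unfolding C_def by (simp add: sum_nonneg)
  \<comment> \<open>the index \<open>m + 1\<close> carries the entry \<open>z n\<close> itself, as \<open>\<beta> n (m + 1) = 1\<close>\<close>
  have "\<exists>y. \<forall>i\<in>{1..m + 1}. of_rat (y i) = \<beta> n i * z n \<and>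
      p_integral CARD('p) (of_nat D * y i) \<and> \<bar>y i\<bar> \<le> C * (1 + P / 2) ^ n" for n
  proof (induction n)
    case 0
    show ?case
      by (rule exI[of _ "\<lambda>i. if i \<le> m then q i else 1"])
        (use q D qC C1 in \<open>auto simp: \<beta>_def z_def intro: p_integral_of_int\<close>)
  next
    case (Suc n)
    then obtain y where y: "\<And>i. i \<in> {1..m + 1} \<Longrightarrow> of_rat (y i) = \<beta> n i * z n"
      "\<And>i. i \<in> {1..m + 1} \<Longrightarrow> p_integral CARD('p) (of_nat D * y i)"
      "\<And>i. i \<in> {1..m + 1} \<Longrightarrow> \<bar>y i\<bar> \<le> C * (1 + P / 2) ^ n" by metis
    define R where "R = C * (1 + P / 2) ^ n"
    have R0: "R \<ge> 0" using C1 P by (simp add: R_def)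
    have last: "of_rat (y (m + 1)) = z n" using y(1)[of "m + 1"] by (simp add: \<beta>_def)
    define y' where "y' i = (if i = 1 then y (m + 1) else y (i - 1) - a n (i - 1) * y (m + 1))" for i
    have "of_rat (y' i) = \<beta> (Suc n) i * z (Suc n) \<and> p_integral CARD('p) (of_nat D * y' i) \<and>
        \<bar>y' i\<bar> \<le> (1 + P / 2) * R" if i: "i \<in> {1..m + 1}" for i
    proof (cases "i = 1")
      case True
      have "R \<le> (1 + P / 2) * R" using P R0 by (simp add: distrib_right)
      then show ?thesis
        using y(2,3)[of "m + 1"] last step(1)[of n] True by (auto simp: y'_def R_def)
    next
      case False
      define j where "j = i - 1"
      have j: "i = Suc j" "j \<in> {1..m}" using False i by (auto simp: j_def)
      have y': "y' i = y j + (- a n j) * y (m + 1)" using j by (simp add: y'_def)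
      have "of_rat (y' i) = \<beta> n j * z n - of_rat (a n j) * z n"
        using y' y(1)[of j] last j by (simp add: of_rat_diff of_rat_mult)
      then have eq: "of_rat (y' i) = \<beta> (Suc n) i * z (Suc n)"
        unfolding j(1) step(2)[OF j(2)] .
      have "of_nat D * y' i = of_nat D * y j + ((- 1) * a n j) * (of_nat D * y (m + 1))"
        unfolding y' by (simp add: algebra_simps)
      moreover have "p_integral CARD('p) ((- 1) * a n j)"
        unfolding a_def jp_partial_def
        by (rule p_integral_mult[OF p_integral_of_int browkin_s_p_integral]) simp
      then have "p_integral CARD('p) (of_nat D * y j + ((- 1) * a n j) * (of_nat D * y (m + 1)))"
        using y(2)[of j] y(2)[of "m + 1"] j(2) by (intro p_integral_add p_integral_mult[of _ "- 1 * a n j"]) auto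
      ultimately have int: "p_integral CARD('p) (of_nat D * y' i)" by simp
      have "\<bar>a n j\<bar> \<le> P / 2" unfolding a_def jp_partial_def P_def by (rule browkin_s_bound[OF odd])
      then have "\<bar>a n j\<bar> * \<bar>y (m + 1)\<bar> \<le> P / 2 * R"
        using y(3)[of "m + 1"] P unfolding R_def by (intro mult_mono) auto
      then have "\<bar>y' i\<bar> \<le> R + P / 2 * R"
        using y(3)[of j] j abs_triangle_ineq[of "y j" "(- a n j) * y (m + 1)"]
        unfolding y' R_def by (simp add: abs_mult)
      then show ?thesis using eq int by (simp add: distrib_right)
    qed
    then show ?case by (intro exI[of _ y']) (auto simp: R_def ac_simps)
  qed
  \<comment> \<open>the last entry never vanishes, so the product formula applies to it\<close>
  then have ex: "\<exists>x. of_rat x = z n \<and> p_integral CARD('p) (of_nat D * x) \<and> \<bar>x\<bar> \<le> C * (1 + P / 2) ^ n" for n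
    by (metis (no_types, lifting) \<beta>_def atLeastAtMost_iff le_add2 mult_1 not_less_eq_eq order_refl Suc_eq_plus1)
  define p where "p = real CARD('p)"
  have p3: "p \<ge> 3" using \<open>CARD('p) \<ge> 3\<close> by (simp add: p_def)
  have "1 \<le> (of_nat D * of_rat C) * ((1 + p / 2) / p) ^ n" for n
  proof -
    obtain x where x: "of_rat x = z n" "p_integral CARD('p) (of_nat D * x)" "\<bar>x\<bar> \<le> C * (1 + P / 2) ^ n"
      using ex by blast
    have x0: "x \<noteq> 0" using z0[of n] x(1) by auto
    have "padic_norm (z n) \<le> (1 / p) ^ n"
    proof -
      have "padic_norm (z n) \<le> (\<Prod>k<n. 1 / p)"
        unfolding z_def padic_norm_prod a_def jp_partial_def \<beta>_def p_def
        using browkin_s_close[OF odd] by (intro prod_mono) auto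
      then show ?thesis by simp
    qed
    moreover have "padic_norm (of_nat D :: 'p padic) \<le> 1"
      using padic_norm_of_int_le_1[of "int D", where ?'p='p] by simp
    ultimately have "padic_norm (of_nat D * z n) \<le> (1 / p) ^ n"
      using mult_mono[of "padic_norm (of_nat D :: 'p padic)" 1 "padic_norm (z n)" "(1 / p) ^ n"]
      by (simp add: padic_norm_mult)
    then have "padic_norm (of_rat (of_nat D * x) :: 'p padic) \<le> (1 / p) ^ n"
      by (simp add: of_rat_mult x(1))
    then have small: "padic_abs CARD('p) (of_nat D * x) \<le> (1 / p) ^ n"
      unfolding padic_norm_of_rat .
    have "of_rat \<bar>of_nat D * x\<bar> \<le> (of_rat (of_nat D * (C * (1 + P / 2) ^ n)) :: real)"
      unfolding of_rat_less_eq abs_mult using x(3) by (auto intro: mult_left_mono)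
    also have "\<dots> = of_nat D * of_rat C * (1 + p / 2) ^ n"
      by (simp add: of_rat_mult of_rat_power of_rat_add of_rat_divide P_def p_def)
    finally have big: "of_rat \<bar>of_nat D * x\<bar> \<le> of_nat D * of_rat C * (1 + p / 2) ^ n" .
    have "1 \<le> of_rat \<bar>of_nat D * x\<bar> * padic_abs CARD('p) (of_nat D * x)"
      by (rule product_formula_bound[OF prime_card x(2)]) (use x0 D in auto)
    also have "\<dots> \<le> (of_nat D * of_rat C * (1 + p / 2) ^ n) * (1 / p) ^ n"
      using big small p3 C1 by (intro mult_mono) (auto simp: padic_abs_nonneg[OF prime_card])
    finally show ?thesis by (simp add: power_divide)
  qed
  moreover have "(\<lambda>n. (of_nat D * of_rat C) * ((1 + p / 2) / p) ^ n) \<longlonglongrightarrow> 0"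
    by (intro tendsto_mult_right_zero LIMSEQ_realpow_zero) (use p3 in \<open>auto simp: field_simps\<close>)
  ultimately have "(1::real) \<le> 0" by (intro LIMSEQ_le_const) auto
  then show False by simp
qed

section \<open>The field generated by the greatest root\<close>

theorem theorem3:
  fixes \<alpha> :: "nat \<Rightarrow> 'p::prime_card padic" and \<mu> :: "'p padic"
    and P :: "rat poly" and m N :: nat
  assumes "odd CARD('p)"
    and "m \<ge> 1" and "N \<ge> 1"
    and "purely_periodic_mcf m \<alpha> N"
    and "P = mcf_char_poly m \<alpha> N"
    and "\<mu> = (\<Prod>n<N. jp_complete m \<alpha> n 1)"
    and "is_greatest_root P \<mu>"
  shows "rat_adjoin {\<mu>} = rat_adjoin (\<alpha> ` {1..m}) \<and> \<mu> \<notin> \<rat>"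
proof
  interpret mcf: periodic_mcf \<alpha> m N by standard (use assms in auto)
  have mu: "\<mu> = mcf.\<mu>" using assms(6) by (simp add: mcf.\<mu>_def)
  let ?K = "rat_adjoin (\<alpha> ` {1..m})"
  have input: "\<alpha> ` {1..m} \<subseteq> rat_adjoin {\<mu>}"
    unfolding mu using mcf.input_in_rat_adjoin_mu by blast
  have "jp_complete m \<alpha> n 1 \<in> ?K" for n
    using assms(2) subset_rat_adjoin[of "\<alpha> ` {1..m}"]
    by (intro complete_quotient_in_subfield is_subfield_rat_adjoin) auto
  then have "\<mu> \<in> ?K" unfolding assms(6) by (intro subfield_prod is_subfield_rat_adjoin)
  then show "rat_adjoin {\<mu>} = ?K"
    using input by (intro equalityI rat_adjoin_minimal is_subfield_rat_adjoin) auto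
  show "\<mu> \<notin> \<rat>"
  proof
    assume "\<mu> \<in> \<rat>"
    then have "rat_adjoin {\<mu>} \<subseteq> \<rat>" by (intro rat_adjoin_minimal is_subfield_Rats) auto
    then have "\<alpha> ` {1..m} \<subseteq> \<rat>" using input by (rule order.trans[rotated])
    then have "\<not> jp_never_stops m \<alpha>" by (intro rational_input_stops assms(1,2)) blast
    then show False using assms(4) by (simp add: purely_periodic_mcf_def)
  qed
qed

end
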